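(* Let $s>0$ and $h>0$ be such that $m=\pi/(sh)$ is an integer, let $\omega(\varphi)=(\cos\varphi,\sin\varphi)$, $\omega_j=\omega(jsh)$, let $\psi\in C^\infty(S^1)$ be even, and let $\chi$ be an interpolation kernel as in the context. For every $f\in C_0^\infty(\mathbb{R}^2)$, set $$f_{\psi,\delta}(x)=2sh\sum_{j=1}^{\pi/(sh)}\psi(\omega_j)\,(\mathcal{H}\mathcal{R}f)(\omega_j,x\cdot\omega_j),\qquad f_{\psi,\chi}=\mathcal{R}'\mathcal{H}g_{\rm int},$$ $$g_{\rm int}(\omega(\varphi),p)=\sum_{j\in\mathbb{Z}}\psi(\omega_j)\,\mathcal{R}f(\omega_j,p)\,\chi\Big(\frac{\varphi-jsh}{sh}\Big).$$ Then, for all $r\ge0$ and all $\theta\in\mathbb{R}/2\pi\mathbb{Z}$, $$f_{\psi,\chi}(r\omega(\theta))=\big(\chi_{sh}*_\theta f_{\psi,\delta}\big)(r\omega(\theta)),$$ where $*_\theta$ is the circular convolution in the angular variable $\theta$ and $\chi_{\epsilon}(\theta)=\epsilon^{-1}\chi(\theta/\epsilon)$ for $\epsilon>0$.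
   Context: The Radon transform in the plane is $\mathcal{R}f(\omega,p)=\int_{x\cdot\omega=p}f\,d\ell$, $\omega\in S^1$, $p\in\mathbb{R}$, and its transpose (backprojection) is $\mathcal{R}'g(x)=\int_{S^1}g(\omega,x\cdot\omega)\,d\omega$. The operator $\mathcal{H}=\frac1{4\pi}H\partial_p$ acts in the $p$ variable, with $Hg(p)=\frac1\pi\,\mathrm{pv}\!\int\frac{g(t)}{p-t}\,dt$ the Hilbert transform; equivalently $\mathcal{H}=\frac1{4\pi}|D_p|$. The interpolation kernel $\chi$ is a Schwartz function on $\mathbb{R}$ with $\mathrm{supp}\,\hat\chi\subset[-\pi,\pi]$ and $\hat\chi(\hat\varphi)=1$ for $|\hat\varphi|\le\pi B'/B$, for some constants $0<B'<B$. The sum over $j\in\mathbb{Z}$ makes $g_{\rm int}$ a $2\pi$-periodic function of $\varphi$ (equivalently: sum over the $2m$ distinct directions on the circle with the $2\pi$-periodization of $\varphi\mapsto\chi(\varphi/(sh))$). The circular convolution of a function $\chi_\epsilon$ on $\mathbb{R}$ with a $2\pi$-periodic function $u(\theta)$ is $(\chi_\epsilon*_\theta u)(\theta)=\int_{\mathbb{R}}\chi_\epsilon(\tilde\varphi)\,u(\theta-\tilde\varphi)\,d\tilde\varphi$; here $u(\theta)=f_{\psi,\delta}(r\omega(\theta))$ with $r$ fixed. *)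

theory Defs
  imports "HOL-Analysis.Analysis"
begin

subsection \<open>Smooth, test and Schwartz functions\<close>

text \<open>
  For a list \<open>bs\<close> of basis vectors, \<open>iter_deriv bs f\<close> is the corresponding iterated partial
  derivative of \<open>f\<close>. All functions below are complex-valued; real-valued ones are a special case.
\<close>

fun iter_deriv :: "'a list \<Rightarrow> ('a::euclidean_space \<Rightarrow> 'b::real_normed_vector) \<Rightarrow> 'a \<Rightarrow> 'b" where
  "iter_deriv [] f = f"
| "iter_deriv (b # bs) f = (\<lambda>x. frechet_derivative (iter_deriv bs f) (at x) b)"

text \<open>
  Requiring every iterated partial derivative to be (Frechet) differentiable makes all of them
  exist and be continuous, and so is the same as being of class C-infinity.
\<close>

definition smooth :: "('a::euclidean_space \<Rightarrow> 'b::real_normed_vector) \<Rightarrow> bool" where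
  "smooth f \<longleftrightarrow> (\<forall>bs. set bs \<subseteq> Basis \<longrightarrow> (\<forall>x. iter_deriv bs f differentiable (at x)))"

definition test_function :: "('a::euclidean_space \<Rightarrow> 'b::real_normed_vector) \<Rightarrow> bool" where
  "test_function f \<longleftrightarrow> smooth f \<and> compact (closure {x. f x \<noteq> 0})"

definition schwartz :: "('a::euclidean_space \<Rightarrow> 'b::real_normed_vector) \<Rightarrow> bool" where
  "schwartz f \<longleftrightarrow> smooth f \<and>
     (\<forall>k bs. set bs \<subseteq> Basis \<longrightarrow> bounded (range (\<lambda>x. norm x ^ k *\<^sub>R iter_deriv bs f x)))"

subsection \<open>The circle\<close>

definition omega :: "real \<Rightarrow> real^2" where
  "omega \<phi> = vector [cos \<phi>, sin \<phi>]"

text \<open>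
  Functions on the circle are functions on the plane of which only the values at unit vectors
  matter; smoothness is tested in the angular coordinate.
\<close>

definition smooth_on_circle :: "(real^2 \<Rightarrow> complex) \<Rightarrow> bool" where
  "smooth_on_circle \<psi> \<longleftrightarrow> smooth (\<lambda>\<phi>. \<psi> (omega \<phi>))"

definition even_on_circle :: "(real^2 \<Rightarrow> complex) \<Rightarrow> bool" where
  "even_on_circle \<psi> \<longleftrightarrow> (\<forall>\<omega>. norm \<omega> = 1 \<longrightarrow> \<psi> (- \<omega>) = \<psi> \<omega>)"

subsection \<open>Radon transform, backprojection and filter\<close>

text \<open>
  For a unit vector \<open>\<omega>\<close>, the map \<open>t \<mapsto> p \<omega> + t \<omega>\<^sup>\<bottom>\<close>, with \<open>\<omega>\<^sup>\<bottom>\<close> the rotation of \<open>\<omega>\<close> by a right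
  angle, is the arc length parametrization of the line \<open>x \<bullet> \<omega> = p\<close>.
\<close>

definition radon :: "(real^2 \<Rightarrow> complex) \<Rightarrow> real^2 \<Rightarrow> real \<Rightarrow> complex" where
  "radon f \<omega> p = (LINT t|lborel. f (p *\<^sub>R \<omega> + t *\<^sub>R vector [- \<omega>$2, \<omega>$1]))"

definition backprojection :: "(real^2 \<Rightarrow> real \<Rightarrow> complex) \<Rightarrow> real^2 \<Rightarrow> complex" where
  "backprojection g x = (LINT \<phi>:{0..2*pi}|lborel. g (omega \<phi>) (x \<bullet> omega \<phi>))"

definition hilbert_transform :: "(real \<Rightarrow> complex) \<Rightarrow> real \<Rightarrow> complex" where
  "hilbert_transform g p = 1 / of_real pi *
     Lim (at_right 0) (\<lambda>\<epsilon>. LINT t:{t. \<epsilon> < \<bar>p - t\<bar>}|lborel. g t / of_real (p - t))"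

definition radon_filter :: "(real^2 \<Rightarrow> real \<Rightarrow> complex) \<Rightarrow> real^2 \<Rightarrow> real \<Rightarrow> complex" where
  "radon_filter g \<omega> p =
     1 / of_real (4 * pi) * hilbert_transform (\<lambda>t. vector_derivative (g \<omega>) (at t)) p"

subsection \<open>Interpolation kernels\<close>

definition fourier :: "(real \<Rightarrow> complex) \<Rightarrow> real \<Rightarrow> complex" where
  "fourier g \<xi> = (LINT x|lborel. cis (- (x * \<xi>)) * g x)"

definition interpolation_kernel :: "real \<Rightarrow> real \<Rightarrow> (real \<Rightarrow> complex) \<Rightarrow> bool" where
  "interpolation_kernel B' B chi \<longleftrightarrow>
     0 < B' \<and> B' < B \<and> schwartz chi \<and>
     closure {\<xi>. fourier chi \<xi> \<noteq> 0} \<subseteq> {- pi..pi} \<and>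
     (\<forall>\<xi>. \<bar>\<xi>\<bar> \<le> pi * B' / B \<longrightarrow> fourier chi \<xi> = 1)"

definition dilate :: "(real \<Rightarrow> complex) \<Rightarrow> real \<Rightarrow> real \<Rightarrow> complex" where
  "dilate chi \<epsilon> \<theta> = chi (\<theta> / \<epsilon>) / of_real \<epsilon>"

definition circ_conv :: "(real \<Rightarrow> complex) \<Rightarrow> (real \<Rightarrow> complex) \<Rightarrow> real \<Rightarrow> complex" where
  "circ_conv k u \<theta> = (LINT \<phi>|lborel. k \<phi> * u (\<theta> - \<phi>))"

subsection \<open>Reconstructions from discrete directions\<close>

definition sample_dir :: "real \<Rightarrow> real \<Rightarrow> int \<Rightarrow> real^2" where
  "sample_dir s h j = omega (of_int j * s * h)"

text \<open>The integer \<open>m\<close> stands for \<open>\<pi>/(s h)\<close>.\<close>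

definition f_delta ::
  "real \<Rightarrow> real \<Rightarrow> int \<Rightarrow> (real^2 \<Rightarrow> complex) \<Rightarrow> (real^2 \<Rightarrow> complex) \<Rightarrow> real^2 \<Rightarrow> complex" where
  "f_delta s h m \<psi> f x = of_real (2 * s * h) *
     (\<Sum>j = 1..m. \<psi> (sample_dir s h j) *
        radon_filter (radon f) (sample_dir s h j) (x \<bullet> sample_dir s h j))"

text \<open>
  The interpolated data at the direction \<open>\<omega>\<close> are given by a series in an angle \<open>\<phi>\<close> of \<open>\<omega>\<close>; the
  choice of the angle is immaterial when \<open>\<pi>/(s h)\<close> is an integer, see \<open>g_int_omega\<close> below.
\<close>

definition g_int ::
  "real \<Rightarrow> real \<Rightarrow> (real^2 \<Rightarrow> complex) \<Rightarrow> (real \<Rightarrow> complex) \<Rightarrow> (real^2 \<Rightarrow> complex) \<Rightarrow>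
    real^2 \<Rightarrow> real \<Rightarrow> complex" where
  "g_int s h \<psi> chi f \<omega> p =
     (let \<phi> = (SOME \<phi>. omega \<phi> = \<omega>) in
      \<Sum>\<^sub>\<infinity>j\<in>UNIV. \<psi> (sample_dir s h j) * radon f (sample_dir s h j) p *
        chi ((\<phi> - of_int j * s * h) / (s * h)))"

definition f_chi ::
  "real \<Rightarrow> real \<Rightarrow> (real^2 \<Rightarrow> complex) \<Rightarrow> (real \<Rightarrow> complex) \<Rightarrow> (real^2 \<Rightarrow> complex) \<Rightarrow>
    real^2 \<Rightarrow> complex" where
  "f_chi s h \<psi> chi f = backprojection (radon_filter (g_int s h \<psi> chi f))"

lemma omega_eq_iff: "omega \<phi> = omega \<phi>' \<longleftrightarrow> (\<exists>k::int. \<phi> = \<phi>' + 2 * pi * of_int k)"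
proof -
  have "omega \<phi> = omega \<phi>' \<longleftrightarrow> sin \<phi> = sin \<phi>' \<and> cos \<phi> = cos \<phi>'"
    by (auto simp: omega_def vec_eq_iff forall_2)
  also have "\<dots> \<longleftrightarrow> (\<exists>k::int. \<phi> = \<phi>' + 2 * pi * of_int k)"
    using sin_cos_eq_iff[of \<phi> \<phi>'] by simp
  finally show ?thesis .
qed

lemma g_int_omega:
  assumes m: "of_int m = pi / (s * h)" and "s > 0" "h > 0"
  shows "g_int s h \<psi> chi f (omega \<phi>) p =
    (\<Sum>\<^sub>\<infinity>j\<in>UNIV. \<psi> (sample_dir s h j) * radon f (sample_dir s h j) p *
       chi ((\<phi> - of_int j * s * h) / (s * h)))"
proof -
  define \<phi>' where "\<phi>' = (SOME \<phi>'. omega \<phi>' = omega \<phi>)"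
  have "omega \<phi>' = omega \<phi>"
    unfolding \<phi>'_def by (rule someI) (rule refl)
  then obtain k :: int where k: "\<phi>' = \<phi> + 2 * pi * of_int k"
    unfolding omega_eq_iff by blast
  define F where "F \<phi> j = \<psi> (sample_dir s h j) * radon f (sample_dir s h j) p *
       chi ((\<phi> - of_int j * s * h) / (s * h))" for \<phi> j
  have pim: "of_int m * s * h = pi"
    using assms by (simp add: field_simps)
  have dir: "sample_dir s h (j + 2 * m * k) = sample_dir s h j" for j
  proof -
    have "of_int (j + 2 * m * k) * s * h = of_int j * s * h + 2 * (of_int m * s * h) * of_int k"
      by (simp add: algebra_simps)
    then show ?thesis
      unfolding sample_dir_def omega_eq_iff pim by blast
  qed
  have ang: "\<phi>' - of_int (j + 2 * m * k) * s * h = \<phi> - of_int j * s * h" for j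
  proof -
    have "of_int (j + 2 * m * k) * s * h = of_int j * s * h + 2 * (of_int m * s * h) * of_int k"
      by (simp add: algebra_simps)
    then show ?thesis
      unfolding pim by (simp add: k)
  qed
  have "bij (\<lambda>j. j + 2 * m * k)"
    by (rule bij_betw_byWitness[where f' = "\<lambda>j. j - 2 * m * k"]) auto
  then have "(\<Sum>\<^sub>\<infinity>j\<in>UNIV. F \<phi>' (j + 2 * m * k)) = (\<Sum>\<^sub>\<infinity>j\<in>UNIV. F \<phi>' j)"
    by (rule infsum_reindex_bij_betw)
  moreover have "F \<phi>' (j + 2 * m * k) = F \<phi> j" for j
    unfolding F_def dir ang ..
  ultimately have "(\<Sum>\<^sub>\<infinity>j\<in>UNIV. F \<phi>' j) = (\<Sum>\<^sub>\<infinity>j\<in>UNIV. F \<phi> j)"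
    by simp
  then show ?thesis
    unfolding g_int_def Let_def \<phi>'_def[symmetric] F_def .
qed

end

theory Submission
  imports Defs "HOL-Probability.Sinc_Integral"
begin

text \<open>
  The filter acts on \<open>p\<close> only, so it commutes with the interpolation in the angle. Grouping the
  indices modulo \<open>2 m\<close> makes the interpolated data a finite sum over the \<open>2 m\<close> directions, with
  the \<open>2 \<pi>\<close>-periodized kernel as coefficients. Backprojecting one term integrates a periodized
  function over a period, which unfolds to an integral of \<open>\<chi>\<close> over the whole line; since
  \<open>\<omega>(\<theta>) \<bullet> \<omega>(\<phi>)\<close> depends on \<open>\<theta> - \<phi>\<close> only, translating \<open>\<phi>\<close> by \<open>j s h\<close> turns it into a convolution
  in \<open>\<theta>\<close>. Opposite directions contribute equally because \<open>\<psi>\<close> and the filtered Radon data are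
  even, so the sum over \<open>2 m\<close> directions is twice the sum over \<open>m\<close> directions.
\<close>

subsection \<open>Test functions and the Radon transform\<close>

lemma iter_deriv_append: "iter_deriv (bs @ cs) f = iter_deriv bs (iter_deriv cs f)"
  by (induction bs) auto

lemma test_function_differentiable: "test_function f \<Longrightarrow> f differentiable (at x)"
  unfolding test_function_def smooth_def by (metis empty_subsetI iter_deriv.simps(1) set_empty)

lemma test_function_continuous: "test_function f \<Longrightarrow> continuous_on S f"
  by (meson continuous_at_imp_continuous_on differentiable_imp_continuous_within
      test_function_differentiable)

lemma test_function_vanishes_outside_ball:
  assumes "test_function f"
  obtains R where "R > 0" "\<And>x. f x \<noteq> 0 \<Longrightarrow> norm x \<le> R"
proof -
  have "bounded (closure {x. f x \<noteq> 0})"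
    using assms unfolding test_function_def by (simp add: compact_imp_bounded)
  then have "bounded {x. f x \<noteq> 0}"
    by (rule bounded_subset) (rule closure_subset)
  then show ?thesis
    using that unfolding bounded_pos by blast
qed

lemma test_function_bounded:
  assumes "test_function f"
  obtains M where "\<And>x. norm (f x) \<le> M"
proof -
  obtain R where R: "\<And>x. f x \<noteq> 0 \<Longrightarrow> norm x \<le> R"
    using test_function_vanishes_outside_ball[OF assms] by metis
  have "compact (f ` cball 0 R)"
    using assms by (intro compact_continuous_image test_function_continuous) auto
  then obtain M where M: "M > 0" "\<And>x. x \<in> cball 0 R \<Longrightarrow> norm (f x) \<le> M"
    by (metis bounded_pos compact_imp_bounded image_eqI)
  have "norm (f x) \<le> M" for x
  proof (cases "f x = 0")
    case False
    then show ?thesis using M(2)[of x] R[of x] by simp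
  qed (use M(1) in simp)
  then show ?thesis using that by blast
qed

text \<open>\<open>iter_deriv\<close> applies the last list entry first, so appending
  \<open>b\<close> to a list gives the iterated derivatives of the partial derivative. Off the
  closed support \<open>f\<close> vanishes on an open set, hence so does its derivative.\<close>

lemma test_function_partial_derivative:
  assumes f: "test_function f" and b: "b \<in> Basis"
  shows "test_function (\<lambda>x. frechet_derivative f (at x) b)"
proof -
  have "smooth (\<lambda>x. frechet_derivative f (at x) b)"
    unfolding smooth_def
  proof (intro allI impI)
    fix bs :: "'a list" and x assume bs: "set bs \<subseteq> Basis"
    have "iter_deriv (bs @ [b]) f differentiable (at x)"
      using f bs b unfolding test_function_def smooth_def by auto
    then show "iter_deriv bs (\<lambda>x. frechet_derivative f (at x) b) differentiable (at x)"
      by (simp add: iter_deriv_append)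
  qed
  moreover have sub: "{x. frechet_derivative f (at x) b \<noteq> 0} \<subseteq> closure {x. f x \<noteq> 0}"
  proof clarify
    fix x assume ne: "frechet_derivative f (at x) b \<noteq> 0"
    show "x \<in> closure {x. f x \<noteq> 0}"
    proof (rule ccontr)
      assume x: "x \<notin> closure {x. f x \<noteq> 0}"
      have "(f has_derivative (\<lambda>_. 0)) (at x)"
      proof (rule has_derivative_transform_within_open[where f = "\<lambda>_. 0"])
        show "open (- closure {x. f x \<noteq> 0})" by (intro open_Compl closed_closure)
        show "0 = f y" if "y \<in> - closure {x. f x \<noteq> 0}" for y
          using that closure_subset[of "{x. f x \<noteq> 0}"] by auto
      qed (use x in auto)
      then have "frechet_derivative f (at x) = (\<lambda>_. 0)"
        by (rule frechet_derivative_at[symmetric])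
      then show False using ne by simp
    qed
  qed
  moreover have "compact (closure {x. frechet_derivative f (at x) b \<noteq> 0})"
  proof -
    have "bounded (closure {x. f x \<noteq> 0})"
      using f unfolding test_function_def by (simp add: compact_imp_bounded)
    then show ?thesis
      unfolding compact_closure using sub by (rule bounded_subset)
  qed
  ultimately show ?thesis
    unfolding test_function_def by blast
qed

text \<open>Writing the derivative through partial derivatives, which are test functions again,
  later turns the p-derivative of Radon data into a finite combination of Radon data.\<close>

lemma test_function_has_derivative:
  assumes "test_function f"
  shows "(f has_derivative (\<lambda>v. \<Sum>b\<in>Basis. (v \<bullet> b) *\<^sub>R frechet_derivative f (at x) b)) (at x)"
proof -
  have D: "(f has_derivative frechet_derivative f (at x)) (at x)"
    using test_function_differentiable[OF assms] frechet_derivative_works by blast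
  have "frechet_derivative f (at x) v = (\<Sum>b\<in>Basis. (v \<bullet> b) *\<^sub>R frechet_derivative f (at x) b)" for v
  proof -
    have "linear (frechet_derivative f (at x))"
      using D by (rule has_derivative_linear)
    then have "frechet_derivative f (at x) (\<Sum>b\<in>Basis. (v \<bullet> b) *\<^sub>R b) =
        (\<Sum>b\<in>Basis. (v \<bullet> b) *\<^sub>R frechet_derivative f (at x) b)"
      by (simp add: linear_sum linear_scale)
    then show ?thesis by (simp add: euclidean_representation)
  qed
  then have "frechet_derivative f (at x) = (\<lambda>v. \<Sum>b\<in>Basis. (v \<bullet> b) *\<^sub>R frechet_derivative f (at x) b)" ..
  with D show ?thesis by simp
qed

section \<open>The Radon transform of a test function along parametrized lines\<close>

lemma norm_line_point:
  fixes \<omega> :: "real^2"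
  assumes "norm \<omega> = 1"
  shows "(norm (p *\<^sub>R \<omega> + t *\<^sub>R vector [- \<omega>$2, \<omega>$1]))\<^sup>2 = p\<^sup>2 + t\<^sup>2"
proof -
  have w: "(\<omega>$1)\<^sup>2 + (\<omega>$2)\<^sup>2 = 1"
    using assms by (simp add: norm_eq_1 inner_vec_def sum_2 power2_eq_square)
  have "(norm (p *\<^sub>R \<omega> + t *\<^sub>R vector [- \<omega>$2, \<omega>$1]))\<^sup>2 =
      (p\<^sup>2 + t\<^sup>2) * ((\<omega>$1)\<^sup>2 + (\<omega>$2)\<^sup>2)"
    unfolding power2_norm_eq_inner
    by (simp add: inner_vec_def sum_2 power2_eq_square algebra_simps)
  then show ?thesis using w by simp
qed

text \<open>The first bound confines the Radon data of a compactly supported function in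
  \<open>p\<close>; the second confines the line integral in \<open>t\<close>, uniformly in
  \<open>p\<close>.\<close>

lemma line_point_bounds:
  fixes \<omega> :: "real^2"
  assumes "norm \<omega> = 1"
  shows "\<bar>p\<bar> \<le> norm (p *\<^sub>R \<omega> + t *\<^sub>R vector [- \<omega>$2, \<omega>$1])"
    and "\<bar>t\<bar> \<le> norm (p *\<^sub>R \<omega> + t *\<^sub>R vector [- \<omega>$2, \<omega>$1])"
  using norm_line_point[OF assms, of p t]
    abs_le_square_iff[of p "norm (p *\<^sub>R \<omega> + t *\<^sub>R vector [- \<omega>$2, \<omega>$1])"]
    abs_le_square_iff[of t "norm (p *\<^sub>R \<omega> + t *\<^sub>R vector [- \<omega>$2, \<omega>$1])"]
  by simp_all

lemma radon_eq_zero: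
  assumes "norm \<omega> = 1" and "\<And>x. f x \<noteq> 0 \<Longrightarrow> norm x \<le> R" and "R < \<bar>p\<bar>"
  shows "radon f \<omega> p = 0"
proof -
  have "f (p *\<^sub>R \<omega> + t *\<^sub>R vector [- \<omega>$2, \<omega>$1]) = 0" for t
    using assms(2)[of "p *\<^sub>R \<omega> + t *\<^sub>R vector [- \<omega>$2, \<omega>$1]"]
      line_point_bounds(1)[OF assms(1), of p t] assms(3) by linarith
  then show ?thesis by (simp add: radon_def)
qed

text \<open>The interval of integration is the same for all \<open>p\<close>, so that one may
  differentiate under the integral.\<close>

lemma radon_eq_integral:
  assumes w: "norm \<omega> = 1" and R: "\<And>x. f x \<noteq> 0 \<Longrightarrow> norm x \<le> R" and f: "continuous_on UNIV f"
  shows "radon f \<omega> p = integral (cbox (-R) R) (\<lambda>t. f (p *\<^sub>R \<omega> + t *\<^sub>R vector [- \<omega>$2, \<omega>$1]))"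
proof -
  let ?g = "\<lambda>t. f (p *\<^sub>R \<omega> + t *\<^sub>R vector [- \<omega>$2, \<omega>$1])"
  have "?g t = indicator {-R..R} t *\<^sub>R ?g t" for t
  proof (cases "?g t = 0")
    case False
    then have "\<bar>t\<bar> \<le> R"
      using R line_point_bounds(2)[OF w, of t p] order_trans by blast
    then show ?thesis by (auto simp: indicator_def)
  qed simp
  then have "radon f \<omega> p = (LINT t:{-R..R}|lborel. ?g t)"
    unfolding radon_def set_lebesgue_integral_def by simp
  also have "\<dots> = integral {-R..R} ?g"
    by (intro set_borel_integral_eq_integral borel_integrable_atLeastAtMost' continuous_on_compose2[OF f])
      (auto intro!: continuous_intros)
  finally show ?thesis by simp
qed

text \<open>Leibniz rule, with the chain rule along the unit-speed motion of the line in direction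
  \<omega>. Since the derivative is expressed by Radon transforms of test functions, whatever is
  proved for Radon data passes to their p-derivatives.\<close>

lemma radon_has_vector_derivative:
  assumes f: "test_function f" and w: "norm \<omega> = 1"
  shows "(radon f \<omega> has_vector_derivative
    (\<Sum>b\<in>Basis. (\<omega> \<bullet> b) *\<^sub>R radon (\<lambda>x. frechet_derivative f (at x) b) \<omega> p)) (at p)"
proof -
  define D where "D b x = frechet_derivative f (at x) b" for b x
  define l where "l p t = p *\<^sub>R \<omega> + t *\<^sub>R vector [- \<omega>$2, \<omega>$1]" for p t :: real
  have D: "test_function (D b)" if "b \<in> Basis" for b
    unfolding D_def using f that by (rule test_function_partial_derivative)
  obtain R0 where R0: "R0 > 0" "\<And>x. f x \<noteq> 0 \<Longrightarrow> norm x \<le> R0"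
    using test_function_vanishes_outside_ball[OF f] by metis
  have "\<exists>r. \<forall>x. D b x \<noteq> 0 \<longrightarrow> norm x \<le> r" if "b \<in> Basis" for b
    using test_function_vanishes_outside_ball[OF D[OF that]] by metis
  then obtain r where r: "\<And>b x. b \<in> Basis \<Longrightarrow> D b x \<noteq> 0 \<Longrightarrow> norm x \<le> r b"
    by metis
  \<comment> \<open>One radius serves \<open>f\<close> and all its partial derivatives, so both
    sides of the Leibniz rule live on the same interval and convert back to Radon
    transforms.\<close>
  define R where "R = Max (insert R0 (r ` Basis))"
  have Rf: "norm x \<le> R" if "f x \<noteq> 0" for x
    using R0(2)[OF that] unfolding R_def by (simp add: Max_ge_iff)
  have RD: "norm x \<le> R" if "b \<in> Basis" "D b x \<noteq> 0" for b x
    using r[OF that] that(1) unfolding R_def by (subst Max_ge_iff) auto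
  have cont_l: "continuous_on S (\<lambda>(p, t). l p t)" for S
    unfolding l_def case_prod_unfold by (intro continuous_intros)
  have cont_D: "continuous_on S (\<lambda>(p, t). D b (l p t))" if "b \<in> Basis" for b S
    using continuous_on_compose2[OF test_function_continuous[OF D[OF that], of UNIV] cont_l]
    by (auto simp: case_prod_unfold)
  have int_f: "(\<lambda>t. f (l p t)) integrable_on cbox (-R) R" for p
    unfolding l_def
    by (intro integrable_continuous continuous_on_compose2[OF test_function_continuous[OF f, of UNIV]])
      (auto intro!: continuous_intros)
  have int_D: "(\<lambda>t. D b (l p t)) integrable_on cbox (-R) R" if "b \<in> Basis" for p b
    unfolding l_def
    by (intro integrable_continuous
        continuous_on_compose2[OF test_function_continuous[OF D[OF that], of UNIV]])
      (auto intro!: continuous_intros)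
  have "((\<lambda>p. integral (cbox (-R) R) (\<lambda>t. f (l p t))) has_vector_derivative
      integral (cbox (-R) R) (\<lambda>t. \<Sum>b\<in>Basis. (\<omega> \<bullet> b) *\<^sub>R D b (l p t))) (at p within UNIV)"
  proof (rule leibniz_rule_vector_derivative)
    fix p t
    have "((\<lambda>p. l p t) has_derivative (\<lambda>h. h *\<^sub>R \<omega>)) (at p)"
      unfolding l_def by (auto intro!: derivative_eq_intros)
    then have "((\<lambda>p. f (l p t)) has_derivative
        (\<lambda>h. \<Sum>b\<in>Basis. ((h *\<^sub>R \<omega>) \<bullet> b) *\<^sub>R D b (l p t))) (at p)"
      unfolding D_def by (rule has_derivative_compose) (rule test_function_has_derivative[OF f])
    then show "((\<lambda>p. f (l p t)) has_vector_derivative (\<Sum>b\<in>Basis. (\<omega> \<bullet> b) *\<^sub>R D b (l p t)))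
        (at p within UNIV)"
      unfolding has_vector_derivative_def by (simp add: scaleR_sum_right)
  next
    show "continuous_on (UNIV \<times> cbox (-R) R) (\<lambda>(p, t). \<Sum>b\<in>Basis. (\<omega> \<bullet> b) *\<^sub>R D b (l p t))"
      using cont_D unfolding case_prod_unfold by (intro continuous_intros) auto
  qed (use int_f in auto)
  moreover have "integral (cbox (-R) R) (\<lambda>t. \<Sum>b\<in>Basis. (\<omega> \<bullet> b) *\<^sub>R D b (l p t)) =
      (\<Sum>b\<in>Basis. (\<omega> \<bullet> b) *\<^sub>R radon (D b) \<omega> p)"
    using radon_eq_integral[OF w RD test_function_continuous[OF D], where p = p] int_D[where p = p]
    by (subst integral_sum) (auto simp: l_def intro!: integrable_cmul sum.cong)
  moreover have "radon f \<omega> = (\<lambda>p. integral (cbox (-R) R) (\<lambda>t. f (l p t)))"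
    using radon_eq_integral[OF w Rf test_function_continuous[OF f]] by (auto simp: l_def)
  ultimately show ?thesis
    by (simp add: D_def[abs_def])
qed

lemma radon_bounded:
  assumes f: "test_function f" and w: "norm \<omega> = 1"
  obtains M where "\<And>p. norm (radon f \<omega> p) \<le> M"
proof -
  obtain R where R: "R > 0" "\<And>x. f x \<noteq> 0 \<Longrightarrow> norm x \<le> R"
    using test_function_vanishes_outside_ball[OF f] by metis
  obtain M where M: "\<And>x. norm (f x) \<le> M"
    using test_function_bounded[OF f] by metis
  have "norm (radon f \<omega> p) \<le> M * (R - (- R))" for p
  proof -
    have "norm (integral {-R..R} (\<lambda>t. f (p *\<^sub>R \<omega> + t *\<^sub>R vector [- \<omega>$2, \<omega>$1]))) \<le> M * (R - (- R))"
    proof (rule integral_bound)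
      show "continuous_on {-R..R} (\<lambda>t. f (p *\<^sub>R \<omega> + t *\<^sub>R vector [- \<omega>$2, \<omega>$1]))"
        by (rule continuous_on_compose2[OF test_function_continuous[OF f, of UNIV]])
          (auto intro!: continuous_intros)
    qed (use R M in auto)
    then show ?thesis
      using radon_eq_integral[OF w R(2) test_function_continuous[OF f], of p] by simp
  qed
  then show ?thesis using that by blast
qed

subsection \<open>The Hilbert transform of compactly supported Lipschitz functions\<close>

text \<open>A class closed under finite linear combinations, containing the p-derivatives of Radon
  data, on which the principal value becomes an absolutely convergent integral: the Lipschitz bound
  tames the singularity and the bounded support removes the tails.\<close>

definition lipschitz_compact :: "(real \<Rightarrow> complex) \<Rightarrow> bool" where
  "lipschitz_compact g \<longleftrightarrow>
     (\<exists>L\<ge>0. \<forall>x y. norm (g x - g y) \<le> L * \<bar>x - y\<bar>) \<and> (\<exists>R>0. \<forall>t. g t \<noteq> 0 \<longrightarrow> \<bar>t\<bar> \<le> R)"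

lemma lipschitz_compactE:
  assumes "lipschitz_compact g"
  obtains L R where "L \<ge> 0" "\<And>x y. norm (g x - g y) \<le> L * \<bar>x - y\<bar>"
    "R > 0" "\<And>t. g t \<noteq> 0 \<Longrightarrow> \<bar>t\<bar> \<le> R"
  using assms unfolding lipschitz_compact_def by metis

lemma lipschitz_compact_add:
  assumes "lipschitz_compact g" "lipschitz_compact k"
  shows "lipschitz_compact (\<lambda>t. g t + k t)"
proof -
  obtain L R where g: "L \<ge> 0" "\<And>x y. norm (g x - g y) \<le> L * \<bar>x - y\<bar>"
      "R > 0" "\<And>t. g t \<noteq> 0 \<Longrightarrow> \<bar>t\<bar> \<le> R"
    using lipschitz_compactE[OF assms(1)] by metis
  obtain L' R' where k: "L' \<ge> 0" "\<And>x y. norm (k x - k y) \<le> L' * \<bar>x - y\<bar>"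
      "R' > 0" "\<And>t. k t \<noteq> 0 \<Longrightarrow> \<bar>t\<bar> \<le> R'"
    using lipschitz_compactE[OF assms(2)] by metis
  have "norm (g x + k x - (g y + k y)) \<le> (L + L') * \<bar>x - y\<bar>" for x y
  proof -
    have "norm ((g x - g y) + (k x - k y)) \<le> L * \<bar>x - y\<bar> + L' * \<bar>x - y\<bar>"
      using g(2) k(2) by (intro norm_triangle_mono)
    then show ?thesis by (simp add: algebra_simps)
  qed
  moreover have "\<bar>t\<bar> \<le> max R R'" if "g t + k t \<noteq> 0" for t
  proof (cases "g t = 0")
    case True
    then show ?thesis using k(4)[of t] that by simp
  qed (use g(4)[of t] in simp)
  ultimately show ?thesis
    unfolding lipschitz_compact_def using g(1,3) k(1,3)
    by (metis add_nonneg_nonneg less_max_iff_disj)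
qed

lemma lipschitz_compact_cmult:
  assumes "lipschitz_compact g"
  shows "lipschitz_compact (\<lambda>t. c * g t)"
proof -
  obtain L R where g: "L \<ge> 0" "\<And>x y. norm (g x - g y) \<le> L * \<bar>x - y\<bar>"
      "R > 0" "\<And>t. g t \<noteq> 0 \<Longrightarrow> \<bar>t\<bar> \<le> R"
    using lipschitz_compactE[OF assms] by metis
  have "norm (c * g x - c * g y) \<le> norm c * L * \<bar>x - y\<bar>" for x y
    using mult_left_mono[OF g(2)[of x y] norm_ge_zero[of c]]
    by (simp add: norm_mult mult.assoc flip: right_diff_distrib)
  moreover have "\<bar>t\<bar> \<le> R" if "c * g t \<noteq> 0" for t
    using that g(4)[of t] by simp
  ultimately show ?thesis
    unfolding lipschitz_compact_def using g(1,3) by (metis mult_nonneg_nonneg norm_ge_zero)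
qed

lemma lipschitz_compact_sum:
  assumes "\<And>i. i \<in> I \<Longrightarrow> lipschitz_compact (g i)"
  shows "lipschitz_compact (\<lambda>t. \<Sum>i\<in>I. g i t)"
proof -
  have zero: "lipschitz_compact (\<lambda>t. 0)"
    unfolding lipschitz_compact_def by (auto intro: exI[of _ 1] exI[of _ 0])
  show ?thesis
    using assms
    by (induction I rule: infinite_finite_induct) (auto intro: zero lipschitz_compact_add)
qed

lemma lipschitz_compact_continuous:
  assumes "lipschitz_compact g"
  shows "continuous_on UNIV g"
proof -
  obtain L where "L \<ge> 0" "\<And>x y. norm (g x - g y) \<le> L * \<bar>x - y\<bar>"
    using lipschitz_compactE[OF assms] by metis
  then have "L-lipschitz_on UNIV g"
    by (auto intro!: lipschitz_onI simp: dist_norm)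
  then show ?thesis by (rule lipschitz_on_continuous_on)
qed

lemma lipschitz_compact_measurable: "lipschitz_compact g \<Longrightarrow> g \<in> borel_measurable borel"
  by (intro borel_measurable_continuous_onI lipschitz_compact_continuous)

text \<open>The average of \<open>g (p - u) / u\<close> over \<open>u\<close> and
  \<open>- u\<close>; the factor 2 is there because the integral runs over the whole line and not
  over \<open>u > 0\<close>. At \<open>u = 0\<close> division by zero gives the value 0.\<close>

definition odd_quotient :: "(real \<Rightarrow> complex) \<Rightarrow> real \<Rightarrow> real \<Rightarrow> complex" where
  "odd_quotient g p u = (g (p - u) - g (p + u)) / of_real (2 * u)"

text \<open>The Lipschitz estimate cancels the denominator, and for \<bar>u\<bar> > R + r both
  arguments have left the support of \<open>g\<close>. The bound is uniform over \<bar>p\<bar> \<le>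
  r, which later bounds the Hilbert transform on compact intervals.\<close>

lemma odd_quotient_bound:
  assumes L: "L \<ge> 0" "\<And>x y. norm (g x - g y) \<le> L * \<bar>x - y\<bar>"
    and R: "\<And>t. g t \<noteq> 0 \<Longrightarrow> \<bar>t\<bar> \<le> R" and p: "\<bar>p\<bar> \<le> r"
  shows "norm (odd_quotient g p u) \<le> L * indicator {-(R + r)..R + r} u"
proof (cases "\<bar>u\<bar> \<le> R + r \<and> u \<noteq> 0")
  case True
  have "norm (g (p - u) - g (p + u)) \<le> L * \<bar>2 * u\<bar>"
    using L(2)[of "p - u" "p + u"] by (simp add: abs_mult)
  then show ?thesis
    using True by (auto simp: odd_quotient_def norm_divide norm_mult field_simps abs_le_iff indicator_def)
next
  case False
  have "odd_quotient g p u = 0"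
  proof (cases "u = 0")
    case u: False
    then have "\<not> \<bar>p - u\<bar> \<le> R" "\<not> \<bar>p + u\<bar> \<le> R"
      using False p by linarith+
    then have "g (p - u) = 0" "g (p + u) = 0"
      using R by blast+
    then show ?thesis by (simp add: odd_quotient_def)
  qed (simp add: odd_quotient_def)
  then show ?thesis using L(1) by simp
qed

lemma odd_quotient_measurable [measurable]:
  assumes [measurable]: "g \<in> borel_measurable borel"
  shows "(\<lambda>(p, u). odd_quotient g p u) \<in> borel_measurable (borel \<Otimes>\<^sub>M borel)"
  unfolding odd_quotient_def[abs_def] by measurable

lemma integrable_mult_indicator_Icc: "integrable lborel (\<lambda>u::real. c * indicator {a..b} u :: real)"
  by (intro integrable_mult_right integrable_real_indicator) (auto simp: emeasure_lborel_Icc_eq)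

lemma odd_quotient_integrable:
  assumes "lipschitz_compact g"
  shows "integrable lborel (odd_quotient g p)"
proof -
  obtain L R where g: "L \<ge> 0" "\<And>x y. norm (g x - g y) \<le> L * \<bar>x - y\<bar>"
      "R > 0" "\<And>t. g t \<noteq> 0 \<Longrightarrow> \<bar>t\<bar> \<le> R"
    using lipschitz_compactE[OF assms] by metis
  have [measurable]: "g \<in> borel_measurable borel"
    using assms by (rule lipschitz_compact_measurable)
  show ?thesis
  proof (rule Bochner_Integration.integrable_bound)
    show "integrable lborel (\<lambda>u. L * indicator {-(R + \<bar>p\<bar>)..R + \<bar>p\<bar>} u :: real)"
      by (rule integrable_mult_indicator_Icc)
    show "odd_quotient g p \<in> borel_measurable lborel"
      unfolding odd_quotient_def[abs_def] by measurable
    show "AE u in lborel. norm (odd_quotient g p u) \<le> norm (L * indicator {-(R + \<bar>p\<bar>)..R + \<bar>p\<bar>} u :: real)"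
    proof (rule AE_I2)
      fix u
      have "norm (odd_quotient g p u) \<le> L * indicator {-(R + \<bar>p\<bar>)..R + \<bar>p\<bar>} u"
        using g by (intro odd_quotient_bound) auto
      then show "norm (odd_quotient g p u) \<le> norm (L * indicator {-(R + \<bar>p\<bar>)..R + \<bar>p\<bar>} u :: real)"
        by simp
    qed
  qed
qed

text \<open>
  Averaging over \<open>u \<mapsto> - u\<close> turns the truncated integral of \<open>g (p - u) / u\<close> into that of the
  bounded function \<^const>\<open>odd_quotient\<close>, so that the truncation can be removed.
\<close>

lemma truncated_hilbert_integral:
  assumes g: "lipschitz_compact g" and e: "\<epsilon> > 0"
  shows "(LINT t:{t. \<epsilon> < \<bar>p - t\<bar>}|lborel. g t / of_real (p - t)) =
    (LINT u:{u. \<epsilon> < \<bar>u\<bar>}|lborel. odd_quotient g p u)"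
proof -
  obtain L R where L: "L \<ge> 0" "\<And>x y. norm (g x - g y) \<le> L * \<bar>x - y\<bar>"
      and R: "R > 0" "\<And>t. g t \<noteq> 0 \<Longrightarrow> \<bar>t\<bar> \<le> R"
    using lipschitz_compactE[OF g] by metis
  have [measurable]: "g \<in> borel_measurable borel"
    using g by (rule lipschitz_compact_measurable)
  have gbound: "norm (g t) \<le> L * (2 * R + 1)" for t
  proof (cases "g t = 0")
    case False
    \<comment> \<open>Comparing with a point just outside the support bounds \<open>g\<close>
      globally; points of the support are at distance at most \<open>2 * R + 1\<close> from
      it.\<close>
    have "g (- R - 1) = 0" using R(2)[of "- R - 1"] R(1) by fastforce
    then have "norm (g t) \<le> L * \<bar>t - (- R - 1)\<bar>" using L(2)[of t "- R - 1"] by simp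
    also have "\<dots> \<le> L * (2 * R + 1)"
      using L(1) R(1) R(2)[OF False] by (intro mult_left_mono) auto
    finally show ?thesis .
  qed (use L R in simp)
  \<comment> \<open>The truncated integrand after the substitution \<open>u = p - t\<close>.\<close>
  define h where "h u = indicator {u. \<epsilon> < \<bar>u\<bar>} u *\<^sub>R (g (p - u) / of_real u)" for u
  have int_h: "integrable lborel h"
  proof (rule Bochner_Integration.integrable_bound)
    let ?b = "\<lambda>u. L * (2 * R + 1) / \<epsilon> * indicator {-(R + \<bar>p\<bar>)..R + \<bar>p\<bar>} u :: real"
    show "integrable lborel ?b" by (rule integrable_mult_indicator_Icc)
    show "h \<in> borel_measurable lborel"
      unfolding h_def[abs_def] by measurable
    show "AE u in lborel. norm (h u) \<le> norm (?b u)"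
    proof (rule AE_I2)
      fix u
      show "norm (h u) \<le> norm (?b u)"
      proof (cases "g (p - u) = 0 \<or> \<not> \<epsilon> < \<bar>u\<bar>")
        case True
        then show ?thesis by (auto simp: h_def)
      next
        case False
        then have "\<bar>p - u\<bar> \<le> R" using R(2) by blast
        then have "u \<in> {-(R + \<bar>p\<bar>)..R + \<bar>p\<bar>}" by auto
        moreover have "norm (g (p - u)) / \<bar>u\<bar> \<le> L * (2 * R + 1) / \<epsilon>"
          using gbound[of "p - u"] False e L R by (intro frac_le) auto
        ultimately show ?thesis
          using False L R e by (simp add: h_def norm_divide)
      qed
    qed
  qed
  have "(LINT t:{t. \<epsilon> < \<bar>p - t\<bar>}|lborel. g t / of_real (p - t)) = (LINT u|lborel. h u)"
    unfolding set_lebesgue_integral_def h_def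
    by (subst lborel_integral_real_affine[where c = "-1" and t = p]) (auto simp: indicator_def)
  also have "\<dots> = ((LINT u|lborel. h u) + (LINT u|lborel. h (- u))) / 2"
    using lborel_integral_real_affine[of "-1" h 0] by simp
  also have "\<dots> = (LINT u|lborel. (h u + h (- u)) / 2)"
    using int_h lborel_integrable_real_affine[OF int_h, of "-1" 0] by simp
  also have "\<dots> = (LINT u|lborel. indicator {u. \<epsilon> < \<bar>u\<bar>} u *\<^sub>R odd_quotient g p u)"
  proof (intro Bochner_Integration.integral_cong refl)
    fix u
    show "(h u + h (- u)) / 2 = indicator {u. \<epsilon> < \<bar>u\<bar>} u *\<^sub>R odd_quotient g p u"
      by (cases "\<epsilon> < \<bar>u\<bar>") (simp_all add: h_def odd_quotient_def diff_divide_distrib mult.commute)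
  qed
  finally show ?thesis by (simp add: set_lebesgue_integral_def)
qed

text \<open>The truncated integral misses only \<bar>u\<bar> \<le> \<epsilon>, where the integrand
  is bounded by a Lipschitz constant, so the error is O(\<epsilon>). Convergence has to be shown
  because \<open>Lim\<close> has a meaningful value only if the limit exists.\<close>

lemma hilbert_transform_eq:
  assumes g: "lipschitz_compact g"
  shows "hilbert_transform g p = 1 / of_real pi * (LINT u|lborel. odd_quotient g p u)"
proof -
  define I where "I \<epsilon> = (LINT t:{t. \<epsilon> < \<bar>p - t\<bar>}|lborel. g t / of_real (p - t))" for \<epsilon>
  define J where "J = (LINT u|lborel. odd_quotient g p u)"
  obtain L R where L: "L \<ge> 0" "\<And>x y. norm (g x - g y) \<le> L * \<bar>x - y\<bar>"
      and R: "R > 0" "\<And>t. g t \<noteq> 0 \<Longrightarrow> \<bar>t\<bar> \<le> R"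
    using lipschitz_compactE[OF g] by metis
  note int = odd_quotient_integrable[OF g, of p]
  have bound: "norm (odd_quotient g p u) \<le> L" for u
  proof -
    have "norm (odd_quotient g p u) \<le> L * indicator {-(R + \<bar>p\<bar>)..R + \<bar>p\<bar>} u"
      using L R by (intro odd_quotient_bound) auto
    also have "\<dots> \<le> L * 1" using L(1) by (intro mult_left_mono) (auto simp: indicator_def)
    finally show ?thesis by simp
  qed
  have diff: "norm (I \<epsilon> - J) \<le> 2 * L * \<epsilon>" if e: "\<epsilon> > 0" for \<epsilon>
  proof -
    have "I \<epsilon> = (LINT u|lborel. indicator {u. \<epsilon> < \<bar>u\<bar>} u *\<^sub>R odd_quotient g p u)"
      unfolding I_def truncated_hilbert_integral[OF g e] by (simp add: set_lebesgue_integral_def)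
    moreover have int': "integrable lborel (\<lambda>u. indicator {u. \<epsilon> < \<bar>u\<bar>} u *\<^sub>R odd_quotient g p u)"
      using int by (intro integrable_mult_indicator) auto
    ultimately have "J - I \<epsilon> =
        (LINT u|lborel. odd_quotient g p u - indicator {u. \<epsilon> < \<bar>u\<bar>} u *\<^sub>R odd_quotient g p u)"
      unfolding J_def using int by (simp add: Bochner_Integration.integral_diff)
    also have "norm \<dots> \<le> (LINT u|lborel. L * indicator {-\<epsilon>..\<epsilon>} u)"
    proof (rule Bochner_Integration.integral_norm_bound_integral)
      show "integrable lborel (\<lambda>u. odd_quotient g p u - indicator {u. \<epsilon> < \<bar>u\<bar>} u *\<^sub>R odd_quotient g p u)"
        using int int' by (rule Bochner_Integration.integrable_diff)
      show "integrable lborel (\<lambda>u. L * indicator {-\<epsilon>..\<epsilon>} u :: real)" by (rule integrable_mult_indicator_Icc)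
      show "norm (odd_quotient g p u - indicator {u. \<epsilon> < \<bar>u\<bar>} u *\<^sub>R odd_quotient g p u)
          \<le> L * indicator {-\<epsilon>..\<epsilon>} u" for u
        using bound[of u] L(1) by (cases "\<epsilon> < \<bar>u\<bar>") (auto simp: indicator_def)
    qed
    also have "\<dots> = 2 * L * \<epsilon>" using e by simp
    finally show ?thesis by (simp add: norm_minus_commute)
  qed
  have "((\<lambda>\<epsilon>. I \<epsilon> - J) \<longlongrightarrow> 0) (at_right 0)"
  proof (rule Lim_null_comparison)
    show "eventually (\<lambda>\<epsilon>. norm (I \<epsilon> - J) \<le> 2 * L * \<epsilon>) (at_right 0)"
      using diff by (auto simp: eventually_at_right_field intro: exI[of _ 1])
    have "((\<lambda>\<epsilon>. 2 * L * \<epsilon>) \<longlongrightarrow> 2 * L * 0) (at_right 0)"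
      by (intro tendsto_intros)
    then show "((\<lambda>\<epsilon>. 2 * L * \<epsilon>) \<longlongrightarrow> 0) (at_right 0)" by simp
  qed
  then have "(I \<longlongrightarrow> J) (at_right 0)" by (simp add: Lim_null[symmetric])
  then have "Lim (at_right 0) I = J" by (intro tendsto_Lim) auto
  then show ?thesis unfolding hilbert_transform_def I_def[abs_def] J_def by simp
qed

text \<open>Linearity is read off from the absolutely convergent integral:
  \<open>odd_quotient\<close> is linear in \<open>g\<close>, and each summand is integrable.\<close>

lemma hilbert_transform_sum:
  assumes "\<And>i. i \<in> I \<Longrightarrow> lipschitz_compact (g i)"
  shows "hilbert_transform (\<lambda>t. \<Sum>i\<in>I. c i * g i t) p = (\<Sum>i\<in>I. c i * hilbert_transform (g i) p)"
proof -
  have "odd_quotient (\<lambda>t. \<Sum>i\<in>I. c i * g i t) p u = (\<Sum>i\<in>I. c i * odd_quotient (g i) p u)" for u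
    unfolding odd_quotient_def sum_subtractf[symmetric] sum_divide_distrib
    by (rule sum.cong) (simp_all add: right_diff_distrib)
  then have "(LINT u|lborel. odd_quotient (\<lambda>t. \<Sum>i\<in>I. c i * g i t) p u) =
      (LINT u|lborel. (\<Sum>i\<in>I. c i * odd_quotient (g i) p u))" by simp
  also have "\<dots> = (\<Sum>i\<in>I. LINT u|lborel. c i * odd_quotient (g i) p u)"
    by (intro Bochner_Integration.integral_sum integrable_mult_right odd_quotient_integrable assms)
  also have "\<dots> = (\<Sum>i\<in>I. c i * (LINT u|lborel. odd_quotient (g i) p u))"
    by simp
  finally have eq: "(LINT u|lborel. odd_quotient (\<lambda>t. \<Sum>i\<in>I. c i * g i t) p u) = \<dots>" .
  have "lipschitz_compact (\<lambda>t. \<Sum>i\<in>I. c i * g i t)"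
    by (intro lipschitz_compact_sum lipschitz_compact_cmult assms)
  then have "hilbert_transform (\<lambda>t. \<Sum>i\<in>I. c i * g i t) p =
      1 / of_real pi * (\<Sum>i\<in>I. c i * (LINT u|lborel. odd_quotient (g i) p u))"
    by (simp only: hilbert_transform_eq eq)
  also have "\<dots> = (\<Sum>i\<in>I. c i * (1 / of_real pi * (LINT u|lborel. odd_quotient (g i) p u)))"
    unfolding sum_distrib_left by (intro sum.cong refl mult.left_commute)
  also have "\<dots> = (\<Sum>i\<in>I. c i * hilbert_transform (g i) p)"
    by (intro sum.cong refl) (simp only: hilbert_transform_eq[OF assms])
  finally show ?thesis .
qed

text \<open>The sign and the exchange of \<open>p - u\<close> with \<open>p + u\<close> compensate
  each other in the odd quotient. The combination \<open>- g (- t)\<close> is what the chain rule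
  produces from reflected Radon data.\<close>

lemma hilbert_transform_odd_reflection:
  assumes g: "lipschitz_compact g"
  shows "hilbert_transform (\<lambda>t. - g (- t)) p = hilbert_transform g (- p)"
proof -
  obtain L R where L: "L \<ge> 0" "\<And>x y. norm (g x - g y) \<le> L * \<bar>x - y\<bar>"
      and R: "R > 0" "\<And>t. g t \<noteq> 0 \<Longrightarrow> \<bar>t\<bar> \<le> R"
    using lipschitz_compactE[OF g] by metis
  have "norm (- g (- x) - - g (- y)) \<le> L * \<bar>x - y\<bar>" for x y
    using L(2)[of "- y" "- x"] by (simp add: norm_minus_commute)
  moreover have "\<bar>t\<bar> \<le> R" if "- g (- t) \<noteq> 0" for t
    using R(2)[of "- t"] that by simp
  ultimately have g': "lipschitz_compact (\<lambda>t. - g (- t))"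
    unfolding lipschitz_compact_def using L(1) R(1) by metis
  have "odd_quotient (\<lambda>t. - g (- t)) p u = odd_quotient g (- p) u" for u
    by (simp add: odd_quotient_def)
  then show ?thesis
    using hilbert_transform_eq[OF g] hilbert_transform_eq[OF g'] by presburger
qed

section \<open>Measurability and local bounds of the Hilbert transform\<close>

lemma hilbert_transform_measurable:
  assumes g: "lipschitz_compact g"
  shows "hilbert_transform g \<in> borel_measurable borel"
proof -
  have [measurable]: "g \<in> borel_measurable borel"
    using g by (rule lipschitz_compact_measurable)
  have "(\<lambda>p. 1 / of_real pi * (LINT u|lborel. odd_quotient g p u)) \<in> borel_measurable borel"
    by measurable
  then show ?thesis
    by (simp add: hilbert_transform_eq[OF g, abs_def])
qed

text \<open>Backprojection at a point of norm \<open>r\<close> samples the filtered data at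
  \<bar>p\<bar> \<le> r only, so a bound on that interval is what integrability over the angle calls
  for.\<close>

lemma hilbert_transform_locally_bounded:
  assumes g: "lipschitz_compact g"
  obtains M where "\<And>p. \<bar>p\<bar> \<le> r \<Longrightarrow> norm (hilbert_transform g p) \<le> M"
proof -
  obtain L R where L: "L \<ge> 0" "\<And>x y. norm (g x - g y) \<le> L * \<bar>x - y\<bar>"
      and R: "R > 0" "\<And>t. g t \<noteq> 0 \<Longrightarrow> \<bar>t\<bar> \<le> R"
    using lipschitz_compactE[OF g] by metis
  have "norm (hilbert_transform g p) \<le> (LINT u|lborel. L * indicator {-(R + r)..R + r} u) / pi"
    if "\<bar>p\<bar> \<le> r" for p
  proof -
    have "norm (LINT u|lborel. odd_quotient g p u) \<le> (LINT u|lborel. L * indicator {-(R + r)..R + r} u)"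
    proof (rule Bochner_Integration.integral_norm_bound_integral)
      show "integrable lborel (odd_quotient g p)"
        using g by (rule odd_quotient_integrable)
      show "integrable lborel (\<lambda>u. L * indicator {-(R + r)..R + r} u :: real)" by (rule integrable_mult_indicator_Icc)
      show "norm (odd_quotient g p u) \<le> L * indicator {-(R + r)..R + r} u" for u
        using L R(2) that by (rule odd_quotient_bound)
    qed
    moreover have "norm (hilbert_transform g p) = norm (LINT u|lborel. odd_quotient g p u) / pi"
      unfolding hilbert_transform_eq[OF g] norm_mult norm_divide by simp
    ultimately show ?thesis
      by (simp only:) (rule divide_right_mono, auto)
  qed
  then show ?thesis using that by blast
qed

subsection \<open>The filter applied to Radon data\<close>

text \<open>The p-derivative is a finite combination of bounded Radon transforms, so the mean value
  inequality gives the Lipschitz constant.\<close>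

lemma radon_lipschitz_compact:
  assumes f: "test_function f" and w: "norm \<omega> = 1"
  shows "lipschitz_compact (radon f \<omega>)"
proof -
  define D where "D p = (\<Sum>b\<in>Basis. (\<omega> \<bullet> b) *\<^sub>R radon (\<lambda>x. frechet_derivative f (at x) b) \<omega> p)" for p
  have "\<exists>M. \<forall>p. norm (radon (\<lambda>x. frechet_derivative f (at x) b) \<omega> p) \<le> M" if "b \<in> Basis" for b
    using radon_bounded[OF test_function_partial_derivative[OF f that] w] by metis
  then obtain M where M: "\<And>b p. b \<in> Basis \<Longrightarrow> norm (radon (\<lambda>x. frechet_derivative f (at x) b) \<omega> p) \<le> M b"
    by metis
  define L where "L = (\<Sum>b\<in>Basis. \<bar>\<omega> \<bullet> b\<bar> * M b)"
  have D: "norm (D p) \<le> L" for p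
    unfolding D_def L_def using M by (intro sum_norm_le) (simp add: mult_left_mono)
  then have L: "L \<ge> 0" using norm_ge_zero order_trans by blast
  have "norm (radon f \<omega> x - radon f \<omega> y) \<le> L * norm (x - y)" for x y
  proof (rule differentiable_bound[OF convex_UNIV])
    fix p
    show "(radon f \<omega> has_derivative (\<lambda>h. h *\<^sub>R D p)) (at p within UNIV)"
      using radon_has_vector_derivative[OF f w, of p] unfolding D_def has_vector_derivative_def .
    show "onorm (\<lambda>h. h *\<^sub>R D p) \<le> L"
      using D[of p] L by (intro onorm_bound) (simp_all add: mult.commute[of _ "norm (D p)"] mult_right_mono)
  qed simp_all
  moreover obtain R where R: "R > 0" "\<And>x. f x \<noteq> 0 \<Longrightarrow> norm x \<le> R"
    using test_function_vanishes_outside_ball[OF f] by metis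
  moreover have "\<bar>p\<bar> \<le> R" if "radon f \<omega> p \<noteq> 0" for p
    using radon_eq_zero[OF w R(2)] that by (meson not_le)
  ultimately show ?thesis
    unfolding lipschitz_compact_def using L by (metis real_norm_def)
qed

text \<open>The p-derivative is a combination of Radon data of test functions, each covered by
  \<open>radon_lipschitz_compact\<close>. This puts the argument of the Hilbert transform in
  \<open>radon_filter\<close> into the right class.\<close>

lemma radon_derivative_lipschitz_compact:
  assumes f: "test_function f" and w: "norm \<omega> = 1"
  shows "lipschitz_compact (\<lambda>t. vector_derivative (radon f \<omega>) (at t))"
proof -
  have "lipschitz_compact (\<lambda>t. \<Sum>b\<in>Basis. of_real (\<omega> \<bullet> b) * radon (\<lambda>x. frechet_derivative f (at x) b) \<omega> t)"
    by (intro lipschitz_compact_sum lipschitz_compact_cmult radon_lipschitz_compact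
        test_function_partial_derivative f w)
  moreover have "vector_derivative (radon f \<omega>) (at t) =
      (\<Sum>b\<in>Basis. of_real (\<omega> \<bullet> b) * radon (\<lambda>x. frechet_derivative f (at x) b) \<omega> t)" for t
    unfolding vector_derivative_at[OF radon_has_vector_derivative[OF f w]] scaleR_conv_of_real ..
  ultimately show ?thesis by simp
qed

lemma radon_has_vector_derivative_vector_derivative:
  assumes "test_function f" and "norm \<omega> = 1"
  shows "(radon f \<omega> has_vector_derivative vector_derivative (radon f \<omega>) (at t)) (at t)"
  by (rule vector_derivative_works[THEN iffD1]) (rule differentiableI_vector[OF radon_has_vector_derivative[OF assms]])

text \<open>Both pairs (\<omega>, - p) and (- \<omega>, p) describe the same line, traversed in
  opposite directions; substituting \<open>- t\<close> for \<open>t\<close> reconciles the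
  two.\<close>

lemma radon_reflect: "radon f (- \<omega>) p = radon f \<omega> (- p)"
proof -
  have v: "vector [- (- \<omega>)$2, (- \<omega>)$1] = - (vector [- \<omega>$2, \<omega>$1] :: real^2)"
    by (simp add: vec_eq_iff forall_2)
  have "radon f (- \<omega>) p = (LINT t|lborel. f ((- p) *\<^sub>R \<omega> + (0 + (- 1) * t) *\<^sub>R vector [- \<omega>$2, \<omega>$1]))"
    unfolding radon_def v by simp
  also have "\<dots> = radon f \<omega> (- p)"
    unfolding radon_def by (subst (2) lborel_integral_real_affine[where c = "-1" and t = 0]) simp_all
  finally show ?thesis .
qed

text \<open>Radon data are even in (\<omega>, p). Differentiating in \<open>p\<close> introduces a
  sign, and the Hilbert transform removes it.\<close>

lemma radon_filter_reflect:
  assumes f: "test_function f" and w: "norm \<omega> = 1"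
  shows "radon_filter (radon f) (- \<omega>) p = radon_filter (radon f) \<omega> (- p)"
proof -
  have "vector_derivative (radon f (- \<omega>)) (at t) = - vector_derivative (radon f \<omega>) (at (- t))" for t
  proof (rule vector_derivative_at)
    have "(uminus has_vector_derivative (- 1)) (at t)"
      by (auto intro!: derivative_eq_intros simp: has_vector_derivative_def)
    from vector_diff_chain_at[OF this radon_has_vector_derivative_vector_derivative[OF f w, of "- t"]]
    have "((radon f \<omega> \<circ> uminus) has_vector_derivative - vector_derivative (radon f \<omega>) (at (- t))) (at t)"
      by simp
    moreover have "radon f (- \<omega>) = radon f \<omega> \<circ> uminus"
      by (simp add: fun_eq_iff radon_reflect)
    ultimately show "(radon f (- \<omega>) has_vector_derivative - vector_derivative (radon f \<omega>) (at (- t))) (at t)"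
      by simp
  qed
  then show ?thesis
    using hilbert_transform_odd_reflection[OF radon_derivative_lipschitz_compact[OF f w], of p]
    by (simp add: radon_filter_def)
qed

text \<open>The filter sees only the profile of \<open>g\<close> at the one direction \<omega>. The
  coefficients are constant in \<open>p\<close>, and the directions \<open>w i\<close> may differ
  from \<omega>; this is how the filter commutes with angular interpolation.\<close>

lemma radon_filter_sum:
  assumes f: "test_function f" and w: "\<And>i. i \<in> I \<Longrightarrow> norm (w i) = 1"
    and g: "\<And>p. g \<omega> p = (\<Sum>i\<in>I. c i * radon f (w i) p)"
  shows "radon_filter g \<omega> p = (\<Sum>i\<in>I. c i * radon_filter (radon f) (w i) p)"
proof -
  have "vector_derivative (g \<omega>) (at t) = (\<Sum>i\<in>I. c i * vector_derivative (radon f (w i)) (at t))" for t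
  proof (rule vector_derivative_at)
    have "((\<lambda>p. \<Sum>i\<in>I. c i * radon f (w i) p) has_vector_derivative
        (\<Sum>i\<in>I. c i * vector_derivative (radon f (w i)) (at t))) (at t)"
      by (intro has_vector_derivative_sum has_vector_derivative_mult_right
          radon_has_vector_derivative_vector_derivative f w)
    then show "(g \<omega> has_vector_derivative (\<Sum>i\<in>I. c i * vector_derivative (radon f (w i)) (at t))) (at t)"
      by (simp add: g[abs_def])
  qed
  then have "radon_filter g \<omega> p = 1 / of_real (4 * pi) *
      (\<Sum>i\<in>I. c i * hilbert_transform (\<lambda>t. vector_derivative (radon f (w i)) (at t)) p)"
    using hilbert_transform_sum[of I "\<lambda>i t. vector_derivative (radon f (w i)) (at t)" c p]
      radon_derivative_lipschitz_compact[OF f w]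
    by (simp add: radon_filter_def)
  also have "\<dots> = (\<Sum>i\<in>I. c i * radon_filter (radon f) (w i) p)"
    unfolding radon_filter_def sum_distrib_left by (intro sum.cong refl mult.left_commute)
  finally show ?thesis .
qed

lemma radon_filter_measurable:
  assumes "test_function f" and "norm \<omega> = 1"
  shows "radon_filter (radon f) \<omega> \<in> borel_measurable borel"
  using hilbert_transform_measurable[OF radon_derivative_lipschitz_compact[OF assms]]
  unfolding radon_filter_def[abs_def] by measurable

lemma radon_filter_locally_bounded:
  assumes "test_function f" and "norm \<omega> = 1"
  obtains M where "\<And>p. \<bar>p\<bar> \<le> r \<Longrightarrow> norm (radon_filter (radon f) \<omega> p) \<le> M"
proof -
  obtain M where M: "\<And>p. \<bar>p\<bar> \<le> r \<Longrightarrow>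
      norm (hilbert_transform (\<lambda>t. vector_derivative (radon f \<omega>) (at t)) p) \<le> M"
    using hilbert_transform_locally_bounded[OF radon_derivative_lipschitz_compact[OF assms]] by metis
  have "norm (radon_filter (radon f) \<omega> p) \<le> 1 / (4 * pi) * M" if "\<bar>p\<bar> \<le> r" for p
  proof -
    have "norm (radon_filter (radon f) \<omega> p) =
        1 / (4 * pi) * norm (hilbert_transform (\<lambda>t. vector_derivative (radon f \<omega>) (at t)) p)"
      by (simp add: radon_filter_def norm_mult norm_divide)
    also have "\<dots> \<le> 1 / (4 * pi) * M" by (intro mult_left_mono M that) simp
    finally show ?thesis .
  qed
  then show ?thesis using that by blast
qed

subsection \<open>Decay of the kernel and periodization\<close>

lemma schwartz_continuous: "schwartz g \<Longrightarrow> continuous_on S g"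
  unfolding schwartz_def smooth_def
  by (metis continuous_at_imp_continuous_on differentiable_imp_continuous_within empty_subsetI
      iter_deriv.simps(1) set_empty)

text \<open>Adding the Schwartz bounds for the powers 0 and 2 gives a majorant that is both
  integrable over the line and summable over the integers.\<close>

lemma schwartz_quadratic_decay:
  fixes g :: "real \<Rightarrow> complex"
  assumes "schwartz g"
  obtains C where "C \<ge> 0" "\<And>x. norm (g x) \<le> C * inverse (1 + x\<^sup>2)"
proof -
  have "bounded (range (\<lambda>x. norm x ^ k *\<^sub>R g x))" for k
  proof -
    have "\<forall>k bs. set bs \<subseteq> Basis \<longrightarrow> bounded (range (\<lambda>x. norm x ^ k *\<^sub>R iter_deriv bs g x))"
      using assms unfolding schwartz_def by blast
    from this[rule_format, of "[]" k] show ?thesis by simp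
  qed
  then have "\<exists>C. \<forall>x. norm (norm x ^ k *\<^sub>R g x) \<le> C" for k
    unfolding bounded_iff by blast
  then obtain C where C: "\<And>k x. norm (norm x ^ k *\<^sub>R g x) \<le> C k"
    by metis
  have "norm (g x) \<le> (C 0 + C 2) * inverse (1 + x\<^sup>2)" for x
  proof -
    have pos: "1 + x\<^sup>2 > 0" by (simp add: add_pos_nonneg)
    have "norm (g x) * (1 + x\<^sup>2) \<le> C 0 + C 2"
      using C[where k = 0 and x = x] C[where k = 2 and x = x] by (simp add: distrib_left mult.commute)
    then show ?thesis using pos by (simp add: field_simps)
  qed
  moreover have "C 0 + C 2 \<ge> 0"
    using C[where k = 0 and x = 0] C[where k = 2 and x = 0] by (smt (verit) norm_ge_zero)
  ultimately show ?thesis using that by blast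
qed

lemma schwartz_integrable:
  fixes g :: "real \<Rightarrow> complex"
  assumes "schwartz g"
  shows "integrable lborel g"
proof -
  obtain C where C: "C \<ge> 0" "\<And>x. norm (g x) \<le> C * inverse (1 + x\<^sup>2)"
    using schwartz_quadratic_decay[OF assms] by metis
  show ?thesis
  proof (rule Bochner_Integration.integrable_bound)
    show "integrable lborel (\<lambda>x::real. C * inverse (1 + x\<^sup>2))"
      using integrable_inverse_1_plus_square by (simp add: set_integrable_def)
    show "g \<in> borel_measurable lborel"
      using borel_measurable_continuous_onI[OF schwartz_continuous[OF assms]] by simp
    show "AE x in lborel. norm (g x) \<le> norm (C * inverse (1 + x\<^sup>2))"
      using C by (auto intro!: AE_I2 order_trans[OF C(2)])
  qed
qed

text \<open>The integers are covered by two copies of the natural numbers; their overlap at 0 does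
  no harm to summability.\<close>

lemma summable_on_int_inverse_square: "(\<lambda>j::int. inverse (1 + (of_int j)\<^sup>2) :: real) summable_on UNIV"
proof -
  let ?f = "\<lambda>j::int. inverse (1 + (of_int j)\<^sup>2) :: real"
  have "summable (\<lambda>n. inverse (1 + (real n)\<^sup>2))"
  proof (rule summable_comparison_test')
    show "summable (\<lambda>n. inverse (real n ^ 2))"
      by (rule inverse_power_summable) simp
    show "norm (inverse (1 + (real n)\<^sup>2)) \<le> inverse (real n ^ 2)" if "n \<ge> 1" for n
      using that by (simp add: le_imp_inverse_le)
  qed
  then have nat: "(\<lambda>n. inverse (1 + (real n)\<^sup>2)) summable_on UNIV"
    by (intro norm_summable_imp_summable_on) simp
  have "?f summable_on range int"
    using nat by (subst summable_on_reindex) (auto simp: o_def)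
  moreover have "?f summable_on range (\<lambda>n. - int n)"
    using nat by (subst summable_on_reindex) (auto simp: o_def inj_on_def)
  ultimately have "?f summable_on (range int \<union> range (\<lambda>n. - int n))"
    by (rule summable_on_union)
  moreover have "range int \<union> range (\<lambda>n. - int n) = UNIV"
  proof -
    have "j \<in> range int \<union> range (\<lambda>n. - int n)" for j
      by (cases j rule: int_cases2) auto
    then show ?thesis by blast
  qed
  ultimately show ?thesis by simp
qed

lemma schwartz_summable_on_int:
  fixes g :: "real \<Rightarrow> complex"
  assumes "schwartz g"
  shows "(\<lambda>j::int. norm (g (y - of_int j))) summable_on UNIV"
proof -
  obtain C where C: "C \<ge> 0" "\<And>x. norm (g x) \<le> C * inverse (1 + x\<^sup>2)"
    using schwartz_quadratic_decay[OF assms] by metis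
  show ?thesis
  proof (rule Infinite_Sum.abs_summable_on_comparison_test')
    show "(\<lambda>j::int. C * (2 * (1 + y\<^sup>2)) * inverse (1 + (of_int j)\<^sup>2)) summable_on UNIV"
      by (intro summable_on_cmult_right summable_on_int_inverse_square)
    fix j :: int
    define z :: real where "z = y - of_int j"
    have j: "of_int j = y - z" by (simp add: z_def)
    have z: "1 + z\<^sup>2 > 0" and jp: "1 + (y - z)\<^sup>2 > 0" by (simp_all add: add_pos_nonneg)
    \<comment> \<open>Peetre's inequality: the right side of the next estimate exceeds its left side
      by exactly this sum of squares. It trades decay in \<open>y - j\<close> for decay in
      \<open>j\<close> at the price of a factor depending on \<open>y\<close>.\<close>
    have "0 \<le> (y + z)\<^sup>2 + 2 * (y * z)\<^sup>2 + 1" by simp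
    then have "1 + (y - z)\<^sup>2 \<le> 2 * (1 + y\<^sup>2) * (1 + z\<^sup>2)"
      by (simp add: power2_eq_square algebra_simps)
    then have "inverse (1 + z\<^sup>2) \<le> 2 * (1 + y\<^sup>2) * inverse (1 + (y - z)\<^sup>2)"
      using z jp by (simp add: field_simps)
    then have "C * inverse (1 + z\<^sup>2) \<le> C * (2 * (1 + y\<^sup>2) * inverse (1 + (y - z)\<^sup>2))"
      using C(1) by (rule mult_left_mono)
    then show "norm (g (y - of_int j)) \<le> C * (2 * (1 + y\<^sup>2)) * inverse (1 + (of_int j)\<^sup>2)"
      using C(2)[of z] unfolding z_def[symmetric] j by (simp add: mult.assoc)
  qed
qed

text \<open>Translates of \<open>{0..<T}\<close> tile the line, and sum and integral may be
  exchanged because the norms on all tiles integrate to at most the integral of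
  \<open>norm (u x)\<close>. Summability at every point makes each \<open>infsum\<close> the actual
  value of the series. The closed interval matches \<open>backprojection\<close>.\<close>

lemma
  fixes u :: "real \<Rightarrow> complex"
  assumes T: "T > 0" and u: "integrable lborel u"
    and sm: "\<And>x. (\<lambda>k::int. norm (u (x + T * of_int k))) summable_on UNIV"
  shows set_integrable_periodization:
      "set_integrable lborel {0..T} (\<lambda>x. \<Sum>\<^sub>\<infinity>k::int. u (x + T * of_int k))" (is ?int)
    and set_integral_periodization:
      "(LINT x:{0..T}|lborel. \<Sum>\<^sub>\<infinity>k::int. u (x + T * of_int k)) = (LINT x|lborel. u x)" (is ?eq)
proof -
  \<comment> \<open>The integers are enumerated by \<open>int_decode\<close>, since the theorems on
    integrating series are indexed by natural numbers.\<close>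
  define t where "t n = T * of_int (int_decode n)" for n
  define A where "A n = {t n..<t n + T}" for n
  \<comment> \<open>The piece of \<open>u\<close> on tile \<open>A n\<close>, moved back to the base
    interval.\<close>
  define v where "v n x = indicator {0..<T} x *\<^sub>R u (x + t n)" for n x
  define S where "S x = (\<Sum>\<^sub>\<infinity>k::int. u (x + T * of_int k))" for x
  \<comment> \<open>The tile of a point is determined by a floor, which gives covering and
    disjointness at once.\<close>
  have A_iff: "x \<in> A n \<longleftrightarrow> int_decode n = \<lfloor>x / T\<rfloor>" for x n
  proof -
    have "x \<in> A n \<longleftrightarrow> of_int (int_decode n) \<le> x / T \<and> x / T < of_int (int_decode n) + 1"
      using T by (simp add: A_def t_def field_simps)
    then show ?thesis by (metis floor_eq_iff)
  qed
  have UN: "(\<Union>n. A n) = UNIV"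
  proof -
    have "x \<in> A (int_encode \<lfloor>x / T\<rfloor>)" for x by (simp add: A_iff)
    then show ?thesis by blast
  qed
  have disj: "A i \<inter> A j = {}" if "i \<noteq> j" for i j
  proof -
    have "x \<notin> A i \<inter> A j" for x
      using that by (metis A_iff IntE int_decode_eq)
    then show ?thesis by blast
  qed
  have A[measurable, simp]: "A n \<in> sets borel" for n by (simp add: A_def)
  have uA: "set_integrable lborel (A n) u" for n
    using u A unfolding set_integrable_def by (intro integrable_mult_indicator) auto
  have v_eq: "v n x = indicator (A n) (t n + 1 * x) *\<^sub>R u (t n + 1 * x)" for n x
    by (simp add: v_def A_def indicator_def add.commute)
  have int_v: "integrable lborel (v n)" for n
    unfolding v_eq[abs_def]
    using lborel_integrable_real_affine[OF uA[unfolded set_integrable_def], of 1 n "t n"] by simp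
  have v_int: "integral\<^sup>L lborel (v n) = (LINT x:A n|lborel. u x)" for n
    unfolding v_eq[abs_def] set_lebesgue_integral_def
    using lborel_integral_real_affine[of 1 "\<lambda>x. indicator (A n) x *\<^sub>R u x" "t n"] by simp
  have v_norm: "(LINT x|lborel. norm (v n x)) = (LINT x:A n|lborel. norm (u x))" for n
    unfolding v_eq[abs_def] set_lebesgue_integral_def
    using lborel_integral_real_affine[of 1 "\<lambda>x. indicator (A n) x *\<^sub>R norm (u x)" "t n"] by simp
  have nA: "set_integrable lborel B (\<lambda>x. norm (u x))" if "B \<in> sets borel" for B
    using u that unfolding set_integrable_def by (intro integrable_mult_indicator) auto
  have sm_norm: "summable (\<lambda>n. LINT x|lborel. norm (v n x))"
  proof (rule summableI_nonneg_bounded)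
    fix n
    have "(\<Sum>i<n. LINT x|lborel. norm (v i x)) = (LINT x:(\<Union>i<n. A i)|lborel. norm (u x))"
      unfolding v_norm
      by (subst set_integral_finite_Union) (use disj nA in \<open>auto simp: disjoint_family_on_def\<close>)
    also have "\<dots> \<le> (LINT x|lborel. norm (u x))"
      unfolding set_lebesgue_integral_def
    proof (rule integral_mono)
      show "integrable lborel (\<lambda>x. indicator (\<Union>i<n. A i) x *\<^sub>R norm (u x))"
        using nA[of "\<Union>i<n. A i"] unfolding set_integrable_def by simp
    qed (use u in \<open>auto simp: indicator_def\<close>)
    finally show "(\<Sum>i<n. LINT x|lborel. norm (v i x)) \<le> (LINT x|lborel. norm (u x))" .
  qed simp
  have sm_v: "summable (\<lambda>n. norm (v n x))" for x
  proof -
    have "(\<lambda>n. norm (u (x + T * of_int (int_decode n)))) summable_on UNIV"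
      using sm[of x] summable_on_reindex_bij_betw[OF bij_int_decode, of "\<lambda>k. norm (u (x + T * of_int k))"]
      by simp
    then have "summable (\<lambda>n. norm (u (x + t n)))"
      unfolding t_def by (rule summable_on_imp_summable)
    then show ?thesis
      by (auto simp: v_def indicator_def)
  qed
  have v_S: "(\<Sum>n. v n x) = indicator {0..<T} x *\<^sub>R S x" for x
  proof (cases "x \<in> {0..<T}")
    case True
    have "(\<lambda>k::int. u (x + T * of_int k)) summable_on UNIV"
      using sm by (rule abs_summable_summable)
    then have "((\<lambda>k::int. u (x + T * of_int k)) has_sum S x) UNIV"
      unfolding S_def by (rule has_sum_infsum)
    then have "((\<lambda>n. u (x + t n)) has_sum S x) UNIV"
      unfolding t_def
      by (subst has_sum_reindex_bij_betw[OF bij_int_decode, of "\<lambda>k. u (x + T * of_int k)"])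
    then have "(\<lambda>n. u (x + t n)) sums S x" by (rule has_sum_imp_sums)
    then show ?thesis using True by (simp add: v_def sums_iff)
  qed (simp add: v_def)
  have AE_v: "AE x in lborel. summable (\<lambda>n. norm (v n x))"
    using sm_v by simp
  have "integrable lborel (\<lambda>x. \<Sum>n. v n x)"
    using int_v AE_v sm_norm by (rule integrable_suminf)
  then have int_S: "integrable lborel (\<lambda>x. indicator {0..<T} x *\<^sub>R S x)"
    by (simp add: v_S)
  \<comment> \<open>Closing the interval changes the integrand only at \<open>T\<close>, a null
    set.\<close>
  have end_null: "indicator {0..<T} x *\<^sub>R S x = indicator {0..T} x *\<^sub>R S x" if "x \<notin> {T}" for x
    using that by (auto simp: indicator_def)
  have "integrable lborel (\<lambda>x. indicator {0..T} x *\<^sub>R S x)"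
    using int_S integrable_discrete_difference[of "{T}" lborel
        "\<lambda>x. indicator {0..<T} x *\<^sub>R S x" "\<lambda>x. indicator {0..T} x *\<^sub>R S x"] end_null
    by simp
  then show ?int unfolding set_integrable_def S_def .
  have "(LINT x|lborel. indicator {0..T} x *\<^sub>R S x) = (LINT x|lborel. indicator {0..<T} x *\<^sub>R S x)"
  proof (rule integral_discrete_difference[of "{T}"])
    show "indicator {0..T} x *\<^sub>R S x = indicator {0..<T} x *\<^sub>R S x" if "x \<notin> {T}" for x
      using end_null[OF that] by (rule sym)
  qed auto
  also have "\<dots> = (LINT x|lborel. (\<Sum>n. v n x))" by (simp add: v_S)
  also have "\<dots> = (\<Sum>n. integral\<^sup>L lborel (v n))"
    using int_v AE_v sm_norm by (rule integral_suminf)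
  also have "\<dots> = (LINT x:(\<Union>n. A n)|lborel. u x)"
    unfolding v_int using disj u A
    by (subst lebesgue_integral_countable_add) (auto simp: UN set_integrable_def)
  also have "\<dots> = (LINT x|lborel. u x)"
    by (simp add: UN set_lebesgue_integral_def)
  finally show ?eq unfolding set_lebesgue_integral_def S_def .
qed

text \<open>The integers split into residue classes modulo \<open>n\<close>. The representatives run
  from 1 to \<open>n\<close> to match the numbering of directions in \<open>f_delta\<close>.\<close>

lemma infsum_int_residues:
  fixes F :: "int \<Rightarrow> 'a::banach"
  assumes n: "n > 0" and F: "\<And>j. j \<in> {1..n} \<Longrightarrow> (\<lambda>k. F (j + n * k)) summable_on UNIV"
  shows "infsum F UNIV = (\<Sum>j = 1..n. \<Sum>\<^sub>\<infinity>k. F (j + n * k))"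
proof -
  define B where "B j = range (\<lambda>k. j + n * k)" for j
  have inj: "inj (\<lambda>k. j + n * k)" for j
    using n by (auto intro: injI)
  have "F summable_on B j" if "j \<in> {1..n}" for j
    unfolding B_def using F[OF that] by (subst summable_on_reindex[OF inj]) (simp add: o_def)
  moreover have "B j \<inter> B j' = {}" if "j \<in> {1..n}" "j' \<in> {1..n}" "j \<noteq> j'" for j j'
  proof (rule ccontr)
    assume "B j \<inter> B j' \<noteq> {}"
    then obtain k k' where "j + n * k = j' + n * k'" unfolding B_def by blast
    then have "j - j' = n * (k' - k)" by (simp add: algebra_simps)
    then have "n dvd j - j'" by simp
    moreover have "\<bar>j - j'\<bar> < n" using that by auto
    ultimately show False using that(3) dvd_imp_le_int[of "j - j'" n] n by auto
  qed
  moreover have "(\<Union>j\<in>{1..n}. B j) = UNIV"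
  proof -
    \<comment> \<open>Reducing \<open>i - 1\<close> and adding 1 back shifts the usual remainders 0
      to \<open>n - 1\<close> to the range from 1 to \<open>n\<close>.\<close>
    have "i \<in> B (1 + (i - 1) mod n)" for i
      unfolding B_def by (rule image_eqI[of _ _ "(i - 1) div n"]) (simp_all add: mod_mult_div_eq)
    moreover have "1 + (i - 1) mod n \<in> {1..n}" for i
      using n pos_mod_bound[of n "i - 1"] pos_mod_sign[of n "i - 1"] by (simp del: pos_mod_bound)
    ultimately show ?thesis by blast
  qed
  ultimately have "infsum F UNIV = (\<Sum>j = 1..n. infsum F (B j))"
    using sum_infsum[of "{1..n}" F B] by simp
  also have "\<dots> = (\<Sum>j = 1..n. \<Sum>\<^sub>\<infinity>k. F (j + n * k))"
    unfolding B_def by (subst infsum_reindex[OF inj]) (simp add: o_def)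
  finally show ?thesis .
qed

subsection \<open>Equally spaced directions\<close>

lemma inner_omega: "omega a \<bullet> omega b = cos (a - b)"
  by (simp add: omega_def inner_vec_def sum_2 cos_diff)

lemma norm_omega: "norm (omega a) = 1"
  by (simp add: norm_eq_1 inner_omega)

lemma norm_sample_dir: "norm (sample_dir s h j) = 1"
  by (simp add: sample_dir_def norm_omega)

lemma omega_add_pi: "omega (a + pi) = - omega a"
  by (simp add: omega_def vec_eq_iff forall_2)

lemma omega_measurable [measurable]: "omega \<in> borel_measurable borel"
proof -
  have eq: "omega = (\<lambda>a. cos a *\<^sub>R axis 1 1 + sin a *\<^sub>R axis 2 1)"
    by (rule ext) (simp add: omega_def vec_eq_iff forall_2 axis_def)
  have "continuous_on UNIV omega"
    unfolding eq by (intro continuous_intros)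
  then show ?thesis by (rule borel_measurable_continuous_onI)
qed

section \<open>Sampling in \<open>2 * m\<close> directions: periodized interpolation and
  backprojection\<close>

context
  fixes s h :: real and m :: int
  assumes s: "s > 0" and h: "h > 0" and m: "of_int m = pi / (s * h)"
begin

lemma sample_period: "of_int m * s * h = pi"
  using m s h by (simp add: field_simps)

lemma sample_period_pos: "m > 0"
proof -
  have "real_of_int m > 0" using m s h by simp
  then show ?thesis by simp
qed

lemma sample_dir_half_turn: "sample_dir s h (j + m) = - sample_dir s h j"
  by (simp add: sample_dir_def distrib_right sample_period omega_add_pi)

lemma sample_dir_full_turn: "sample_dir s h (j + 2 * m * k) = sample_dir s h j"
proof -
  have "of_int (j + 2 * m * k) * s * h = of_int j * s * h + 2 * pi * of_int k"
    using sample_period by (simp add: algebra_simps)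
  then show ?thesis unfolding sample_dir_def omega_eq_iff by blast
qed

text \<open>In units of the step \<open>s * h\<close> the shifts are integers, so this is a
  subfamily of the integer translates of \<open>chi\<close>.\<close>

lemma kernel_summable_full_turns:
  assumes chi: "schwartz chi"
  shows "(\<lambda>k::int. norm (chi ((x - of_int (j + 2 * m * k) * s * h) / (s * h)) :: complex)) summable_on UNIV"
proof -
  have "(\<lambda>i::int. norm (chi (x / (s * h) - of_int i))) summable_on range (\<lambda>k. j + 2 * m * k)"
    using schwartz_summable_on_int[OF chi] by (rule summable_on_subset) simp
  moreover have "inj (\<lambda>k. j + 2 * m * k)"
    using sample_period_pos by (auto intro: injI)
  ultimately have "(\<lambda>k. norm (chi (x / (s * h) - of_int (j + 2 * m * k)))) summable_on UNIV"
    by (subst (asm) summable_on_reindex) (simp_all add: o_def)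
  moreover have "(x - of_int i * s * h) / (s * h) = x / (s * h) - of_int i" for i
    using s h by (simp add: diff_divide_distrib)
  ultimately show ?thesis by (simp only:)
qed

text \<open>Within a residue class modulo \<open>2 * m\<close> the direction is fixed and only the
  kernel varies. Collecting the kernels leaves a finite sum whose coefficients are free of
  \<open>p\<close>, the form required by \<open>radon_filter_sum\<close>.\<close>

lemma g_int_finite_sum:
  assumes chi: "schwartz chi"
  shows "g_int s h \<psi> chi f (omega \<phi>) p =
    (\<Sum>j = 1..2 * m. (\<psi> (sample_dir s h j) *
        (\<Sum>\<^sub>\<infinity>k. chi ((\<phi> - of_int (j + 2 * m * k) * s * h) / (s * h)))) *
      radon f (sample_dir s h j) p)"
proof -
  define F where "F j = \<psi> (sample_dir s h j) * radon f (sample_dir s h j) p *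
    chi ((\<phi> - of_int j * s * h) / (s * h))" for j
  have F: "F (j + 2 * m * k) = \<psi> (sample_dir s h j) * radon f (sample_dir s h j) p *
      chi ((\<phi> - of_int (j + 2 * m * k) * s * h) / (s * h))" for j k
    unfolding F_def sample_dir_full_turn ..
  have "(\<lambda>k. F (j + 2 * m * k)) summable_on UNIV" for j
    unfolding F
    by (rule summable_on_cmult_right)
      (rule abs_summable_summable[OF kernel_summable_full_turns[OF chi]])
  then have "infsum F UNIV = (\<Sum>j = 1..2 * m. \<Sum>\<^sub>\<infinity>k. F (j + 2 * m * k))"
    using sample_period_pos by (intro infsum_int_residues) auto
  also have "\<dots> = (\<Sum>j = 1..2 * m. (\<psi> (sample_dir s h j) *
        (\<Sum>\<^sub>\<infinity>k. chi ((\<phi> - of_int (j + 2 * m * k) * s * h) / (s * h)))) *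
      radon f (sample_dir s h j) p)"
    unfolding F infsum_cmult_right' by (simp only: mult_ac)
  finally show ?thesis
    unfolding g_int_omega[OF m s h] F_def .
qed

text \<open>A full turn of \<phi> leaves the filtered profile unchanged and shifts only the kernel,
  so the integrand over the circle is the periodization of an integrable function on the line.
  Unfolding it and translating by the sample angle gives one term of the convolution.\<close>

lemma periodized_kernel_integral:
  assumes chi: "schwartz chi" and f: "test_function f"
  defines "K j \<phi> \<equiv> (\<Sum>\<^sub>\<infinity>k. chi ((\<phi> - of_int (j + 2 * m * k) * s * h) / (s * h)) :: complex)"
    and "G j \<equiv> radon_filter (radon f) (sample_dir s h j)"
  shows "set_integrable lborel {0..2 * pi} (\<lambda>\<phi>. K j \<phi> * G j (r *\<^sub>R omega \<theta> \<bullet> omega \<phi>))" (is ?int)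
    and "(LINT \<phi>:{0..2 * pi}|lborel. K j \<phi> * G j (r *\<^sub>R omega \<theta> \<bullet> omega \<phi>)) =
      (LINT \<phi>|lborel. chi (\<phi> / (s * h)) * G j (r *\<^sub>R omega (\<theta> - \<phi>) \<bullet> sample_dir s h j))" (is ?eq)
    and "integrable lborel (\<lambda>\<phi>. chi (\<phi> / (s * h)) * G j (r *\<^sub>R omega (\<theta> - \<phi>) \<bullet> sample_dir s h j))" (is ?int')
proof -
  define v where "v \<phi> = chi (\<phi> / (s * h)) * G j (r *\<^sub>R omega (\<theta> - \<phi>) \<bullet> sample_dir s h j)" for \<phi>
  define u where "u \<phi> = chi ((\<phi> - of_int j * s * h) / (s * h)) * G j (r *\<^sub>R omega \<theta> \<bullet> omega \<phi>)" for \<phi>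
  have sh: "s * h \<noteq> 0" using s h by simp
  have [measurable]: "G j \<in> borel_measurable borel"
    unfolding G_def by (rule radon_filter_measurable[OF f norm_sample_dir])
  have [measurable]: "chi \<in> borel_measurable borel"
    using chi by (intro borel_measurable_continuous_onI schwartz_continuous)
  \<comment> \<open>Inner products of \<open>r *\<^sub>R omega \<theta>\<close> with unit vectors
    stay in the interval \<bar>p\<bar> \<le> \<bar>r\<bar>, so a local bound on \<open>G j\<close>
    suffices to dominate by the kernel.\<close>
  obtain M where M: "\<And>p. \<bar>p\<bar> \<le> \<bar>r\<bar> \<Longrightarrow> norm (G j p) \<le> M"
    unfolding G_def using radon_filter_locally_bounded[OF f norm_sample_dir] by metis
  have int_v: "integrable lborel v"
  proof (rule Bochner_Integration.integrable_bound)
    show "integrable lborel (\<lambda>\<phi>. chi (\<phi> / (s * h)) * of_real M)"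
      using lborel_integrable_real_affine[OF schwartz_integrable[OF chi], of "1 / (s * h)" 0] sh by simp
    show "v \<in> borel_measurable lborel"
      unfolding v_def[abs_def] by measurable
    show "AE \<phi> in lborel. norm (v \<phi>) \<le> norm (chi (\<phi> / (s * h)) * of_real M)"
    proof (rule AE_I2)
      fix \<phi>
      have "\<bar>r *\<^sub>R omega (\<theta> - \<phi>) \<bullet> sample_dir s h j\<bar> \<le> \<bar>r\<bar>"
        using abs_cos_le_one[of "\<theta> - \<phi> - of_int j * s * h"]
        by (simp add: sample_dir_def inner_omega abs_mult mult_left_le)
      then have "norm (G j (r *\<^sub>R omega (\<theta> - \<phi>) \<bullet> sample_dir s h j)) \<le> \<bar>M\<bar>"
        using M by (meson abs_ge_self order_trans)
      then show "norm (v \<phi>) \<le> norm (chi (\<phi> / (s * h)) * of_real M)"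
        unfolding v_def norm_mult by (simp add: mult_left_mono)
    qed
  qed
  then show ?int' unfolding v_def .
  \<comment> \<open>The inner product depends only on the difference of angles: the sample angle
    subtracted from \<phi> cancels against the angle of \<open>sample_dir s h j\<close>.\<close>
  have u_v: "u \<phi> = v (- (of_int j * s * h) + 1 * \<phi>)" for \<phi>
  proof -
    have "r *\<^sub>R omega (\<theta> - (- (of_int j * s * h) + 1 * \<phi>)) \<bullet> sample_dir s h j = r *\<^sub>R omega \<theta> \<bullet> omega \<phi>"
      by (simp add: sample_dir_def inner_omega)
    then show ?thesis unfolding u_def v_def by (simp only:) simp
  qed
  have int_u: "integrable lborel u"
    unfolding u_v[abs_def] by (rule lborel_integrable_real_affine[OF int_v]) simp
  \<comment> \<open>Turning \<phi> forward by \<open>k\<close> periods lowers the sample index by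
    \<open>2 * m * k\<close>; the resulting sign of \<open>k\<close> is removed below by reindexing
    with \<open>uminus\<close>.\<close>
  have shift: "u (\<phi> + 2 * pi * of_int k) = chi ((\<phi> - of_int (j + 2 * m * (- k)) * s * h) / (s * h)) *
      G j (r *\<^sub>R omega \<theta> \<bullet> omega \<phi>)" for \<phi> and k :: int
  proof -
    have "\<phi> + 2 * pi * of_int k - of_int j * s * h = \<phi> - of_int (j + 2 * m * (- k)) * s * h"
      using sample_period by (simp add: algebra_simps)
    moreover have "omega (\<phi> + 2 * pi * of_int k) = omega \<phi>"
      unfolding omega_eq_iff by blast
    ultimately show ?thesis unfolding u_def by (simp only:)
  qed
  have bij: "bij (uminus :: int \<Rightarrow> int)"
    by (rule bij_uminus)
  have "(\<lambda>k::int. norm (chi ((\<phi> - of_int (j + 2 * m * (- k)) * s * h) / (s * h)))) summable_on UNIV" for \<phi>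
    using kernel_summable_full_turns[OF chi, of \<phi> j]
      summable_on_reindex_bij_betw[OF bij, of "\<lambda>k. norm (chi ((\<phi> - of_int (j + 2 * m * k) * s * h) / (s * h)))"]
    by simp
  then have sm: "(\<lambda>k::int. norm (u (\<phi> + 2 * pi * of_int k))) summable_on UNIV" for \<phi>
    unfolding shift norm_mult by (rule summable_on_cmult_left)
  have per: "(\<Sum>\<^sub>\<infinity>k::int. u (\<phi> + 2 * pi * of_int k)) = K j \<phi> * G j (r *\<^sub>R omega \<theta> \<bullet> omega \<phi>)" for \<phi>
    unfolding shift infsum_cmult_left' K_def
    using infsum_reindex_bij_betw[OF bij, of "\<lambda>k. chi ((\<phi> - of_int (j + 2 * m * k) * s * h) / (s * h))"]
    by simp
  have T: "2 * pi > 0" by simp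
  show ?int
    using set_integrable_periodization[OF T int_u sm] unfolding per .
  have "(LINT \<phi>:{0..2 * pi}|lborel. K j \<phi> * G j (r *\<^sub>R omega \<theta> \<bullet> omega \<phi>)) = (LINT \<phi>|lborel. u \<phi>)"
    using set_integral_periodization[OF T int_u sm] unfolding per .
  also have "\<dots> = (LINT \<phi>|lborel. v \<phi>)"
    unfolding u_v using lborel_integral_real_affine[of 1 v "- (of_int j * s * h)"] by simp
  finally show ?eq unfolding v_def .
qed

text \<open>A shift of the index by \<open>m\<close> is a half turn, which changes the sign of both
  the direction and the inner product; evenness of \<psi> and \<open>radon_filter_reflect\<close>
  absorb both.\<close>

lemma sum_opposite_directions:
  fixes x :: "real^2"
  assumes f: "test_function f" and \<psi>: "even_on_circle \<psi>"
  defines "A j \<equiv> \<psi> (sample_dir s h j) * radon_filter (radon f) (sample_dir s h j) (x \<bullet> sample_dir s h j)"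
  shows "(\<Sum>j = 1..2 * m. A j) = 2 * (\<Sum>j = 1..m. A j)"
proof -
  have A: "A (j + m) = A j" for j
    using \<psi> norm_sample_dir[of s h j] radon_filter_reflect[OF f norm_sample_dir]
    by (simp add: A_def sample_dir_half_turn even_on_circle_def)
  have "{1..2 * m} = {1..m} \<union> {m + 1..2 * m}" "{1..m} \<inter> {m + 1..2 * m} = {}"
    using sample_period_pos by auto
  then have "(\<Sum>j = 1..2 * m. A j) = (\<Sum>j = 1..m. A j) + (\<Sum>j = m + 1..2 * m. A j)"
    by (simp add: sum.union_disjoint)
  also have "(\<Sum>j = m + 1..2 * m. A j) = (\<Sum>j = 1..m. A (j + m))"
    by (rule sum.reindex_bij_witness[of _ "\<lambda>j. j + m" "\<lambda>j. j - m"]) auto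
  finally show ?thesis by (simp add: A)
qed

lemma f_chi_eq_circ_conv:
  assumes chi: "schwartz chi" and f: "test_function f" and \<psi>: "even_on_circle \<psi>"
  shows "f_chi s h \<psi> chi f (r *\<^sub>R omega \<theta>) =
    circ_conv (dilate chi (s * h)) (\<lambda>\<theta>'. f_delta s h m \<psi> f (r *\<^sub>R omega \<theta>')) \<theta>"
proof -
  define a where "a j = \<psi> (sample_dir s h j)" for j
  define G where "G j = radon_filter (radon f) (sample_dir s h j)" for j
  define K where "K j \<phi> = (\<Sum>\<^sub>\<infinity>k. chi ((\<phi> - of_int (j + 2 * m * k) * s * h) / (s * h)))" for j \<phi>
  define v where "v j \<phi> = chi (\<phi> / (s * h)) * G j (r *\<^sub>R omega (\<theta> - \<phi>) \<bullet> sample_dir s h j)" for j \<phi>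
  note per = periodized_kernel_integral[OF chi f, of _ r \<theta>, folded K_def G_def, folded v_def]
  \<comment> \<open>For fixed \<phi> the weights \<open>a j * K j \<phi>\<close> are constants in
    \<open>p\<close>, so the filter acts on each sampled Radon profile separately.\<close>
  have filt: "radon_filter (g_int s h \<psi> chi f) (omega \<phi>) p = (\<Sum>j = 1..2 * m. a j * K j \<phi> * G j p)" for \<phi> p
    unfolding G_def
    by (rule radon_filter_sum[OF f norm_sample_dir])
      (simp add: g_int_finite_sum[OF chi] a_def K_def)
  have "f_chi s h \<psi> chi f (r *\<^sub>R omega \<theta>) = (LINT \<phi>|lborel. (\<Sum>j = 1..2 * m.
      a j * (indicator {0..2 * pi} \<phi> *\<^sub>R (K j \<phi> * G j (r *\<^sub>R omega \<theta> \<bullet> omega \<phi>)))))"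
    unfolding f_chi_def backprojection_def set_lebesgue_integral_def filt
    by (simp add: scaleR_sum_right mult.assoc)
  also have "\<dots> = (\<Sum>j = 1..2 * m. a j * (LINT \<phi>:{0..2 * pi}|lborel. K j \<phi> * G j (r *\<^sub>R omega \<theta> \<bullet> omega \<phi>)))"
    unfolding set_lebesgue_integral_def integral_mult_right_zero[symmetric]
    using per(1) unfolding set_integrable_def
    by (intro Bochner_Integration.integral_sum integrable_mult_right)
  also have "\<dots> = (\<Sum>j = 1..2 * m. (LINT \<phi>|lborel. a j * v j \<phi>))"
    unfolding per(2) by simp
  also have "\<dots> = (LINT \<phi>|lborel. (\<Sum>j = 1..2 * m. a j * v j \<phi>))"
    using per(3) by (intro Bochner_Integration.integral_sum[symmetric] integrable_mult_right)
  also have "\<dots> = circ_conv (dilate chi (s * h)) (\<lambda>\<theta>'. f_delta s h m \<psi> f (r *\<^sub>R omega \<theta>')) \<theta>"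
    unfolding circ_conv_def
  proof (intro Bochner_Integration.integral_cong refl)
    fix \<phi>
    define A where "A j = a j * G j (r *\<^sub>R omega (\<theta> - \<phi>) \<bullet> sample_dir s h j)" for j
    have "(\<Sum>j = 1..2 * m. a j * v j \<phi>) = chi (\<phi> / (s * h)) * (\<Sum>j = 1..2 * m. A j)"
      unfolding sum_distrib_left v_def A_def by (intro sum.cong refl mult.left_commute)
    also have "(\<Sum>j = 1..2 * m. A j) = 2 * (\<Sum>j = 1..m. A j)"
      unfolding A_def a_def G_def by (rule sum_opposite_directions[OF f \<psi>])
    \<comment> \<open>The 2 from opposite directions supplies the one in the quadrature weight
      \<open>2 * s * h\<close>; the remaining \<open>s * h\<close> cancels the normalization of
      \<open>dilate\<close>.\<close>
    also have "chi (\<phi> / (s * h)) * \<dots> = chi (\<phi> / (s * h)) / of_real (s * h) * (of_real (2 * s * h) * (\<Sum>j = 1..m. A j))"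
      using s h by simp
    finally show "(\<Sum>j = 1..2 * m. a j * v j \<phi>) =
        dilate chi (s * h) \<phi> * f_delta s h m \<psi> f (r *\<^sub>R omega (\<theta> - \<phi>))"
      unfolding dilate_def f_delta_def A_def a_def G_def .
  qed
  finally show ?thesis .
qed

end

theorem theorem5p2:
  fixes s h B B' :: real and m :: int
    and \<psi> :: "real^2 \<Rightarrow> complex" and chi :: "real \<Rightarrow> complex" and f :: "real^2 \<Rightarrow> complex"
    and r \<theta> :: real
  assumes "s > 0" and "h > 0"
    and "of_int m = pi / (s * h)"
    and "smooth_on_circle \<psi>" and "even_on_circle \<psi>"
    and "interpolation_kernel B' B chi"
    and "test_function f"
    and "r \<ge> 0"
  shows "f_chi s h \<psi> chi f (r *\<^sub>R omega \<theta>) =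
    circ_conv (dilate chi (s * h)) (\<lambda>\<theta>'. f_delta s h m \<psi> f (r *\<^sub>R omega \<theta>')) \<theta>"
proof -
  have "schwartz chi"
    using assms(6) unfolding interpolation_kernel_def by blast
  then show ?thesis
    using assms by (intro f_chi_eq_circ_conv)
qed

end
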